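(* Let $n\ge 2$, $a_1,\ldots,a_{n-1}$ positive integers and $\lambda=\sum a_i\omega_i$. Every simple vertex of $P_\lambda$ is of the form $x(E)$ for some $E\subset R$. For $E\subset R$, the point $x(E)$ is a simple vertex of $P_\lambda$ if and only if for any two segments in $E$ with nonempty intersection, this intersection coincides with one of the two segments.
   Context: Let $U=\mathbb R^{\binom n2}$ with coordinates $x_{i,j}$, $1\le i<j\le n$. A Dyck path is a sequence $d=((i_1,j_1),\ldots,(i_N,j_N))$ of pairs with $1\le i_k<j_k\le n$, $j_1-i_1=j_N-i_N=1$, and each $(i_{k+1},j_{k+1})$ equal to $(i_k+1,j_k)$ or $(i_k,j_k+1)$. Put $S(x,d)=\sum_{(i,j)\in d}x_{i,j}$ and $M(\lambda,d)=a_{i_1}+a_{i_1+1}+\ldots+a_{i_N}$. The FFLV polytope is $P_\lambda=\{x\in U: x\ge 0,\ S(x,d)\le M(\lambda,d)\ \forall d\}$. A vertex of a polytope is simple if the tangent cone of the polytope at it is simplicial and unimodular. Let $R$ be the set of segments $[i,j]$ with integers $1\le i<j\le n$. For $i<j$ let $d^{i,j}=((i,i+1),\ldots,(i,j),(i+1,j),\ldots,(j-1,j))$. For $E\subset R$, $x(E)\in U$ is the unique point with $x(E)_{i,j}=0$ if $[i,j]\notin E$ and $S(x(E),d^{i,j})=a_i+\ldots+a_{j-1}$ if $[i,j]\in E$. *)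

theory Defs
  imports "HOL-Analysis.Analysis" "HOL-Analysis.Finite_Function_Topology"
begin

text \<open>The segment \<open>[i,j]\<close> and the coordinate index \<open>(i,j)\<close> are both encoded by the pair
  \<open>(i,j)\<close>. Points of \<open>\<real>^(n choose 2)\<close> are finitely supported functions on
  pairs whose support consists of such pairs with \<open>1 \<le> i < j \<le> n\<close>.\<close>

definition segments :: "nat \<Rightarrow> (nat \<times> nat) set" where
  "segments n = {(i, j). 1 \<le> i \<and> i < j \<and> j \<le> n}"

definition segment :: "nat \<times> nat \<Rightarrow> real set" where
  "segment s = {real (fst s)..real (snd s)}"

type_synonym point = "nat \<times> nat \<Rightarrow>\<^sub>0 real"

definition coord_space :: "nat \<Rightarrow> point set" where
  "coord_space n = {x. Poly_Mapping.keys x \<subseteq> segments n}"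

definition integer_lattice :: "nat \<Rightarrow> point set" where
  "integer_lattice n = {x \<in> coord_space n. \<forall>s. Poly_Mapping.lookup x s \<in> \<int>}"

definition dyck_path :: "nat \<Rightarrow> (nat \<times> nat) list \<Rightarrow> bool" where
  "dyck_path n d \<longleftrightarrow>
     d \<noteq> [] \<and> set d \<subseteq> segments n \<and>
     snd (hd d) = fst (hd d) + 1 \<and> snd (last d) = fst (last d) + 1 \<and>
     (\<forall>k. Suc k < length d \<longrightarrow>
        d ! Suc k = (fst (d ! k) + 1, snd (d ! k)) \<or>
        d ! Suc k = (fst (d ! k), snd (d ! k) + 1))"

definition path_sum :: "point \<Rightarrow> (nat \<times> nat) list \<Rightarrow> real" where
  "path_sum x d = (\<Sum>s\<leftarrow>d. Poly_Mapping.lookup x s)"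

text \<open>The weight \<open>\<lambda> = \<Sum> a\<^sub>i \<omega>\<^sub>i\<close> enters only through its coefficients
  \<open>a\<^sub>1, \<dots>, a\<^sub>n\<^sub>-\<^sub>1\<close>; other values of \<open>a\<close> are never used.\<close>

definition path_bound :: "(nat \<Rightarrow> nat) \<Rightarrow> (nat \<times> nat) list \<Rightarrow> real" where
  "path_bound a d = (\<Sum>k = fst (hd d)..fst (last d). real (a k))"

definition FFLV :: "nat \<Rightarrow> (nat \<Rightarrow> nat) \<Rightarrow> point set" where
  "FFLV n a =
     {x \<in> coord_space n.
        (\<forall>s \<in> segments n. 0 \<le> Poly_Mapping.lookup x s) \<and>
        (\<forall>d. dyck_path n d \<longrightarrow> path_sum x d \<le> path_bound a d)}"

text \<open>The tangent cone is taken with apex at the origin. For a polytope, the cone of feasible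
  directions is already closed.\<close>

definition tangent_cone :: "'a::real_vector set \<Rightarrow> 'a \<Rightarrow> 'a set" where
  "tangent_cone P v = conic hull ((\<lambda>y. y - v) ` P)"

definition simplicial_cone :: "'a::real_vector set \<Rightarrow> bool" where
  "simplicial_cone C \<longleftrightarrow> (\<exists>B. finite B \<and> independent B \<and> C = convex_cone hull B)"

text \<open>A cone is unimodular with respect to the lattice \<open>L\<close> if it is generated by a
  lattice basis of the part of \<open>L\<close> in its linear span.\<close>

definition unimodular_cone :: "'a::real_vector set \<Rightarrow> 'a set \<Rightarrow> bool" where
  "unimodular_cone L C \<longleftrightarrow>
     (\<exists>B. finite B \<and> independent B \<and> C = convex_cone hull B \<and>
        L \<inter> span C = {(\<Sum>b\<in>B. of_int (c b) *\<^sub>R b) |c :: 'a \<Rightarrow> int. True})"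

definition simple_vertex :: "'a::real_vector set \<Rightarrow> 'a set \<Rightarrow> 'a \<Rightarrow> bool" where
  "simple_vertex L P v \<longleftrightarrow>
     v extreme_point_of P \<and>
     simplicial_cone (tangent_cone P v) \<and> unimodular_cone L (tangent_cone P v)"

definition hook :: "nat \<Rightarrow> nat \<Rightarrow> (nat \<times> nat) list" where
  "hook i j = map (\<lambda>k. (i, k)) [i + 1..<j + 1] @ map (\<lambda>k. (k, j)) [i + 1..<j]"

definition is_segment_point ::
    "nat \<Rightarrow> (nat \<Rightarrow> nat) \<Rightarrow> (nat \<times> nat) set \<Rightarrow> point \<Rightarrow> bool" where
  "is_segment_point n a E x \<longleftrightarrow>
     x \<in> coord_space n \<and>
     (\<forall>(i, j) \<in> segments n.
        ((i, j) \<notin> E \<longrightarrow> Poly_Mapping.lookup x (i, j) = 0) \<and>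
        ((i, j) \<in> E \<longrightarrow> path_sum x (hook i j) = (\<Sum>k = i..<j. real (a k))))"

definition segment_point :: "nat \<Rightarrow> (nat \<Rightarrow> nat) \<Rightarrow> (nat \<times> nat) set \<Rightarrow> point" where
  "segment_point n a E = (THE x. is_segment_point n a E x)"

lemma path_sum_hook:
  assumes "i < j"
  shows "path_sum x (hook i j) =
    Poly_Mapping.lookup x (i, j) + (\<Sum>k = i + 1..<j. Poly_Mapping.lookup x (i, k))
      + (\<Sum>k = i + 1..<j. Poly_Mapping.lookup x (k, j))"
  using assms
  by (simp add: path_sum_def hook_def o_def interv_sum_list_conv_sum_set_nat)

function hook_coord :: "(nat \<Rightarrow> nat) \<Rightarrow> (nat \<times> nat) set \<Rightarrow> nat \<Rightarrow> nat \<Rightarrow> real" where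
  "hook_coord a E i j =
     (if (i, j) \<in> E
      then (\<Sum>k = i..<j. real (a k)) - (\<Sum>k = i + 1..<j. hook_coord a E i k)
             - (\<Sum>k = i + 1..<j. hook_coord a E k j)
      else 0)"
  by auto
termination
  by (relation "Wellfounded.measure (\<lambda>(a, E, i, j). j - i)") auto

declare hook_coord.simps [simp del]

lemma finite_segments [simp]: "finite (segments n)"
  by (rule finite_subset[of _ "{..n} \<times> {..n}"]) (auto simp: segments_def)

lemma is_segment_point_ex1: "\<exists>!x. is_segment_point n a E x"
proof (rule ex_ex1I)
  define f where "f = (\<lambda>s. if s \<in> segments n then hook_coord a E (fst s) (snd s) else 0)"
  have fin: "finite {s. f s \<noteq> 0}"
    by (rule finite_subset[OF _ finite_segments[of n]]) (auto simp: f_def)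
  define x where "x = Abs_poly_mapping f"
  have lx: "Poly_Mapping.lookup x = f"
    unfolding x_def using fin by simp
  have "is_segment_point n a E x"
    unfolding is_segment_point_def
  proof (intro conjI ballI)
    show "x \<in> coord_space n"
      by (auto simp: coord_space_def in_keys_iff lx f_def split: if_splits)
  next
    fix s assume s: "s \<in> segments n"
    obtain i j where ij: "s = (i, j)" by fastforce
    have b: "1 \<le> i" "i < j" "j \<le> n" using s ij by (auto simp: segments_def)
    have 1: "(\<Sum>k = i + 1..<j. f (i, k)) = (\<Sum>k = i + 1..<j. hook_coord a E i k)"
      by (rule sum.cong) (use b in \<open>auto simp: f_def segments_def\<close>)
    have 2: "(\<Sum>k = i + 1..<j. f (k, j)) = (\<Sum>k = i + 1..<j. hook_coord a E k j)"
      by (rule sum.cong) (use b in \<open>auto simp: f_def segments_def\<close>)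
    have 3: "f (i, j) = hook_coord a E i j" using s ij by (simp add: f_def)
    show "case s of (i, j) \<Rightarrow>
        ((i, j) \<notin> E \<longrightarrow> Poly_Mapping.lookup x (i, j) = 0) \<and>
        ((i, j) \<in> E \<longrightarrow> path_sum x (hook i j) = (\<Sum>k = i..<j. real (a k)))"
      unfolding ij prod.case path_sum_hook[OF b(2)] lx 1 2 3
      by (subst (1 2) hook_coord.simps) auto
  qed
  then show "\<exists>x. is_segment_point n a E x" ..
next
  fix x y assume x: "is_segment_point n a E x" and y: "is_segment_point n a E y"
  have out: "Poly_Mapping.lookup z s = 0"
    if "is_segment_point n a E z" "s \<notin> segments n" for z s
    using that by (auto simp: is_segment_point_def coord_space_def in_keys_iff)
  have ins: "Poly_Mapping.lookup x (i, j) = Poly_Mapping.lookup y (i, j)"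
    if "(i, j) \<in> segments n" for i j
    using that
  proof (induction "j - i" arbitrary: i j rule: less_induct)
    case less
    then have b: "1 \<le> i" "i < j" "j \<le> n" by (auto simp: segments_def)
    have 1: "(\<Sum>k = i + 1..<j. Poly_Mapping.lookup x (i, k)) =
             (\<Sum>k = i + 1..<j. Poly_Mapping.lookup y (i, k))"
      by (rule sum.cong[OF refl], rule less.hyps) (use b in \<open>auto simp: segments_def\<close>)
    have 2: "(\<Sum>k = i + 1..<j. Poly_Mapping.lookup x (k, j)) =
             (\<Sum>k = i + 1..<j. Poly_Mapping.lookup y (k, j))"
      by (rule sum.cong[OF refl], rule less.hyps) (use b in \<open>auto simp: segments_def\<close>)
    show ?case
    proof (cases "(i, j) \<in> E")
      case True
      have "path_sum x (hook i j) = path_sum y (hook i j)"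
        using x y less.prems True by (fastforce simp: is_segment_point_def)
      then show ?thesis using 1 2 by (simp add: path_sum_hook[OF b(2)])
    next
      case False
      then show ?thesis using x y less.prems by (fastforce simp: is_segment_point_def)
    qed
  qed
  show "x = y"
  proof (rule poly_mapping_eqI)
    fix s :: "nat \<times> nat"
    show "Poly_Mapping.lookup x s = Poly_Mapping.lookup y s"
      using ins[of "fst s" "snd s"] out[OF x, of s] out[OF y, of s]
      by (cases "s \<in> segments n") auto
  qed
qed

lemma segment_point_spec: "is_segment_point n a E (segment_point n a E)"
  unfolding segment_point_def by (rule theI'[OF is_segment_point_ex1])

end

theory Submission
  imports Defs "HOL-Library.List_Lexorder"
begin

text \<open>
  Every inequality \<open>x\<^sub>s \<ge> 0\<close> and \<open>S(x, d) \<le> M(\<lambda>, d)\<close> defines a facet. Hence, if the tangent cone at \<open>v\<close> is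
  simplicial, every active inequality has a dual ray on which it is the only active one not to vanish, and
  there are no linear relations between the active functionals. The relation obtained by exchanging the tails of
  two tight paths through a common cell shows that two such paths agree before or after that cell; the
  relations obtained by flipping a corner show that \<open>v\<close> is nonzero at all corners of tight paths.
  In a family of paths with the exchange property some path has an outer corner lying on no other path,
  so distinct outer corners can be assigned to the tight paths. Since there are at least as many tight paths
  as cells in the support \<open>E\<close> of \<open>v\<close>, the support is the set of outer corners. A cell cannot be an inner corner
  of one tight path and an outer corner of another, so tight paths have no inner corners: they are the hooks
  \<open>d\<^bsup>i,j\<^esup>\<close> with \<open>[i, j] \<in> E\<close>. Thus \<open>v = x(E)\<close>, and the exchange property makes \<open>E\<close> laminar.

  Conversely, if \<open>E\<close> is laminar, the values of \<open>x(E)\<close> along a chain of cells inside \<open>[i, j]\<close> that avoids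
  \<open>(i, j)\<close> sum to less than \<open>a\<^sub>i + \<dots> + a\<^bsub>j-1\<^esub>\<close>. So \<open>x(E)\<close> is positive on \<open>E\<close>, lies in the polytope, and its
  tight paths are exactly the hooks of \<open>E\<close>. The active functionals then form a triangular system with
  diagonal entries \<open>\<plusminus>1\<close>, ordered by \<open>j - i\<close>, so that the tangent cone is simplicial and unimodular.
\<close>

section \<open>Simplicial cones\<close>

lemma convex_cone_hull_finite:
  fixes B :: "'a::real_vector set"
  assumes "finite B"
  shows "convex_cone hull B = {(\<Sum>b\<in>B. k b *\<^sub>R b) |k. \<forall>b\<in>B. 0 \<le> k b}" (is "_ = ?S")
proof (rule subset_antisym)
  have comb: "convex_cone ?S"
    unfolding convex_cone_iff
  proof (intro conjI ballI allI impI)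
    show "0 \<in> ?S"
      by (intro CollectI exI[of _ "\<lambda>_. 0"]) auto
  next
    fix x y assume "x \<in> ?S" "y \<in> ?S"
    then obtain k l where "x = (\<Sum>b\<in>B. k b *\<^sub>R b)" "y = (\<Sum>b\<in>B. l b *\<^sub>R b)"
      "\<forall>b\<in>B. 0 \<le> k b" "\<forall>b\<in>B. 0 \<le> l b" by blast
    then show "x + y \<in> ?S"
      by (intro CollectI exI[of _ "\<lambda>b. k b + l b"]) (auto simp: algebra_simps sum.distrib)
  next
    fix x and c :: real assume "x \<in> ?S" "0 \<le> c"
    then obtain k where "x = (\<Sum>b\<in>B. k b *\<^sub>R b)" "\<forall>b\<in>B. 0 \<le> k b" by blast
    with \<open>0 \<le> c\<close> show "c *\<^sub>R x \<in> ?S"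
      by (intro CollectI exI[of _ "\<lambda>b. c * k b"]) (auto simp: scaleR_sum_right)
  qed
  show "convex_cone hull B \<subseteq> ?S"
  proof (rule hull_minimal[of _ ?S convex_cone, OF subsetI comb])
    fix b assume "b \<in> B"
    then have "b = (\<Sum>x\<in>B. (if x = b then 1 else 0) *\<^sub>R x)"
      using assms by (simp add: if_distrib[of "\<lambda>k. k *\<^sub>R _"] cong: if_cong)
    then show "b \<in> ?S" by (intro CollectI exI[of _ "\<lambda>x. if x = b then 1 else 0"]) auto
  qed
  show "?S \<subseteq> convex_cone hull B"
  proof (rule subsetI)
    fix x assume "x \<in> ?S"
    then obtain k where k: "x = (\<Sum>b\<in>B. k b *\<^sub>R b)" "\<forall>b\<in>B. 0 \<le> k b" by blast
    have "(\<Sum>b\<in>A. k b *\<^sub>R b) \<in> convex_cone hull B" if "A \<subseteq> B" for A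
      using finite_subset[OF that assms] that
    proof (induction A rule: finite_induct)
      case empty
      then show ?case by (simp add: convex_cone_hull_contains_0)
    next
      case (insert b A)
      then have "k b *\<^sub>R b \<in> convex_cone hull B"
        using k(2) by (intro convex_cone_hull_mul) (auto intro: hull_inc)
      then show ?case using insert by (simp add: convex_cone_hull_add)
    qed
    then show "x \<in> convex_cone hull B" using k(1) by simp
  qed
qed

text \<open>If every inequality positive at \<open>b\<close> were also positive at another
  generator, a large multiple of the sum of the other generators minus \<open>b\<close> would
  satisfy all inequalities. It would lie in the cone with coefficient -1 at \<open>b\<close>,
  against independence.\<close>

lemma simplicial_cone_ray_facet:
  fixes B :: "'a::real_vector set" and c :: "'i \<Rightarrow> 'a \<Rightarrow> real"
  assumes B: "finite B" "independent B" and I: "finite I"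
    and lin: "\<And>i. i \<in> I \<Longrightarrow> linear (c i)"
    and cone: "convex_cone hull B = {u \<in> span B. \<forall>i\<in>I. 0 \<le> c i u}"
    and b: "b \<in> B"
  obtains j where "j \<in> I" "0 < c j b" "\<forall>x\<in>B - {b}. c j x = 0"
proof -
  have nonneg: "0 \<le> c i x" if "i \<in> I" "x \<in> B" for i x
    using that cone hull_inc[of x B convex_cone] by auto
  have "\<exists>j\<in>I. 0 < c j b \<and> (\<forall>x\<in>B - {b}. c j x = 0)"
  proof (rule ccontr)
    assume contra: "\<not> ?thesis"
    define p where "p = (\<Sum>x\<in>B - {b}. x)"
    have cp: "c i p = (\<Sum>x\<in>B - {b}. c i x)" if "i \<in> I" for i
      unfolding p_def by (rule linear_sum[OF lin[OF that]])
    have cp0: "0 \<le> c i p" if "i \<in> I" for i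
      using nonneg that by (auto simp: cp intro!: sum_nonneg)
    \<comment> \<open>Terms with \<open>c i p = 0\<close> are 0 by convention; for all other
      \<open>i\<close>, the product \<open>K * c i p\<close> is at least
      \<open>c i b\<close>.\<close>
    define K where "K = (\<Sum>i\<in>I. c i b / c i p)"
    have "0 \<le> c i (K *\<^sub>R p - b)" if i: "i \<in> I" for i
    proof -
      have eq: "c i (K *\<^sub>R p - b) = K * c i p - c i b"
        using lin[OF i] by (simp add: linear_diff linear_scale)
      show ?thesis
      proof (cases "c i b = 0")
        case True
        have "0 \<le> K" unfolding K_def using nonneg cp0 b by (intro sum_nonneg) auto
        then show ?thesis using eq True cp0[OF i] by simp
      next
        case False
        then have "0 < c i b" using nonneg[OF i b] by simp
        then obtain x where "x \<in> B - {b}" "c i x \<noteq> 0" using contra i by blast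
        then have "0 < c i p" unfolding cp[OF i]
          using nonneg[OF i] B(1) by (intro sum_pos2[of _ x]) (auto simp: less_le)
        moreover have "c i b / c i p \<le> K" unfolding K_def
          using I i nonneg cp0 b by (intro member_le_sum) auto
        ultimately show ?thesis using eq by (simp add: field_simps)
      qed
    qed
    moreover have "K *\<^sub>R p - b \<in> span B"
      unfolding p_def using b by (intro span_diff span_scale span_sum span_base) auto
    ultimately have "K *\<^sub>R p - b \<in> convex_cone hull B" using cone by auto
    then obtain k where k: "K *\<^sub>R p - b = (\<Sum>x\<in>B. k x *\<^sub>R x)" "\<forall>x\<in>B. 0 \<le> k x"
      unfolding convex_cone_hull_finite[OF B(1)] by blast
    \<comment> \<open>Two expansions of one vector in the generators are subtracted; independence
      then equates the coefficients at \<open>b\<close>.\<close>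
    have "(\<Sum>x\<in>B. (k x - (if x = b then - 1 else K)) *\<^sub>R x)
        = (\<Sum>x\<in>B. k x *\<^sub>R x) - (\<Sum>x\<in>B. (if x = b then - 1 else K) *\<^sub>R x)"
      by (simp add: scaleR_diff_left sum_subtractf)
    also have "(\<Sum>x\<in>B. (if x = b then - 1 else K) *\<^sub>R x) = K *\<^sub>R p - b"
    proof -
      have "(\<Sum>x\<in>B. (if x = b then - 1 else K) *\<^sub>R x) =
          - b + (\<Sum>x\<in>B - {b}. (if x = b then - 1 else K) *\<^sub>R x)"
        using B(1) b by (subst sum.remove[of B b]) auto
      also have "(\<Sum>x\<in>B - {b}. (if x = b then - 1 else K) *\<^sub>R x) = K *\<^sub>R p"
        unfolding p_def scaleR_sum_right by (rule sum.cong) auto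
      finally show ?thesis by simp
    qed
    finally have "(\<Sum>x\<in>B. (k x - (if x = b then - 1 else K)) *\<^sub>R x) = 0" using k(1) by simp
    from independentD[OF B(2) B(1) subset_refl this b] have "k b = - 1" by simp
    then show False using k(2) b by auto
  qed
  then show ?thesis using that by blast
qed

text \<open>Giving each generator an inequality positive at it alone is injective. A point violating
  only inequality \<open>i\<close> has a negative coefficient at some generator, hence violates the
  inequality given to that generator, which must be \<open>i\<close>. So the assignment is bijective
  and the generators are the dual rays.\<close>

lemma simplicial_cone_irredundant_dual:
  fixes B :: "'a::real_vector set" and c :: "'i \<Rightarrow> 'a \<Rightarrow> real"
  assumes B: "finite B" "independent B" and I: "finite I"
    and lin: "\<And>i. i \<in> I \<Longrightarrow> linear (c i)"
    and cone: "convex_cone hull B = {u \<in> span B. \<forall>i\<in>I. 0 \<le> c i u}"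
    and irredundant: "\<And>i. i \<in> I \<Longrightarrow> \<exists>z\<in>span B. c i z < 0 \<and> (\<forall>j\<in>I - {i}. 0 \<le> c j z)"
  shows "card B \<le> card I"
    and "i \<in> I \<Longrightarrow> \<exists>w\<in>B. 0 < c i w \<and> (\<forall>j\<in>I - {i}. c j w = 0)"
proof -
  have "\<exists>j. j \<in> I \<and> 0 < c j b \<and> (\<forall>x\<in>B - {b}. c j x = 0)" if "b \<in> B" for b
    using simplicial_cone_ray_facet[OF B I lin cone that] by blast
  then have "\<forall>b\<in>B. \<exists>j. j \<in> I \<and> 0 < c j b \<and> (\<forall>x\<in>B - {b}. c j x = 0)" by blast
  from bchoice[OF this] obtain f where
    "\<forall>b\<in>B. f b \<in> I \<and> 0 < c (f b) b \<and> (\<forall>x\<in>B - {b}. c (f b) x = 0)" ..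
  then have f: "f b \<in> I" "0 < c (f b) b" "\<forall>x\<in>B - {b}. c (f b) x = 0" if "b \<in> B" for b
    using that by blast+
  have inj: "inj_on f B"
  proof (rule inj_onI, rule ccontr)
    fix x y assume xy: "x \<in> B" "y \<in> B" "f x = f y" "x \<noteq> y"
    then have "c (f x) y = 0" using f(3)[of x] by blast
    then show False using f(2)[of y] xy by simp
  qed
  show "card B \<le> card I"
    using inj f(1) I by (intro card_inj_on_le[of f]) auto
  have onto: "\<exists>b\<in>B. f b = i" if i: "i \<in> I" for i
  proof -
    obtain z where z: "z \<in> span B" "c i z < 0" "\<forall>j\<in>I - {i}. 0 \<le> c j z"
      using irredundant[OF i] by blast
    obtain k where k: "z = (\<Sum>b\<in>B. k b *\<^sub>R b)"
      using z(1) unfolding span_finite[OF B(1)] by blast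
    have cz: "c j z = (\<Sum>b\<in>B. k b * c j b)" if "j \<in> I" for j
      unfolding k using lin[OF that] by (simp add: linear_sum linear_scale)
    have "\<exists>b\<in>B. k b * c i b < 0"
    proof (rule ccontr)
      assume "\<not> ?thesis"
      then have "0 \<le> (\<Sum>b\<in>B. k b * c i b)" by (intro sum_nonneg) (simp add: not_less)
      then show False using z(2) cz[OF i] by simp
    qed
    then obtain b where b: "b \<in> B" "k b * c i b < 0" by blast
    have "0 \<le> c i b" using b(1) i cone hull_inc[of b B convex_cone] by auto
    then have "k b < 0" using b(2) by (simp add: mult_less_0_iff)
    have "c (f b) z = k b * c (f b) b + (\<Sum>x\<in>B - {b}. k x * c (f b) x)"
      using cz f(1) b(1) B(1) by (simp add: sum.remove)
    also have "(\<Sum>x\<in>B - {b}. k x * c (f b) x) = 0"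
      using f(3)[OF b(1)] by (intro sum.neutral) auto
    finally have "c (f b) z < 0"
      using \<open>k b < 0\<close> f(2)[OF b(1)] by (simp add: mult_neg_pos)
    then have "f b = i" using z(3) f(1)[OF b(1)] by force
    then show ?thesis using b(1) by blast
  qed
  show "\<exists>w\<in>B. 0 < c i w \<and> (\<forall>j\<in>I - {i}. c j w = 0)" if i: "i \<in> I"
  proof -
    obtain b where b: "b \<in> B" "f b = i" using onto[OF i] by blast
    have "c j b = 0" if j: "j \<in> I - {i}" for j
    proof -
      obtain b' where b': "b' \<in> B" "f b' = j" using onto j by blast
      then have "b' \<noteq> b" using b j by auto
      then show ?thesis using f(3)[OF b'(1)] b' b(1) by auto
    qed
    then show ?thesis using f(2)[OF b(1)] b by blast
  qed
qed

section \<open>Dyck paths\<close>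

text \<open>The cell \<open>(i, j)\<close> is pictured in row \<open>i\<close> and column \<open>j\<close>, so a step goes down or to the right.\<close>

definition dyck_step :: "nat \<times> nat \<Rightarrow> nat \<times> nat \<Rightarrow> bool" where
  "dyck_step s t \<longleftrightarrow> t = (fst s + 1, snd s) \<or> t = (fst s, snd s + 1)"

lemma successively_iff_nth:
  "successively P xs \<longleftrightarrow> (\<forall>k. Suc k < length xs \<longrightarrow> P (xs ! k) (xs ! Suc k))"
proof (induction xs)
  case (Cons x xs)
  show ?case
  proof (cases xs)
    case (Cons y ys)
    then show ?thesis using Cons.IH
      by (auto simp: nth_Cons split: nat.splits)
  qed simp
qed simp

lemma dyck_path_iff:
  "dyck_path n d \<longleftrightarrow>
     d \<noteq> [] \<and> set d \<subseteq> segments n \<and>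
     snd (hd d) = fst (hd d) + 1 \<and> snd (last d) = fst (last d) + 1 \<and> successively dyck_step d"
  by (auto simp: dyck_path_def successively_iff_nth dyck_step_def)

lemma segments_iff: "s \<in> segments n \<longleftrightarrow> 1 \<le> fst s \<and> fst s < snd s \<and> snd s \<le> n"
  by (cases s) (auto simp: segments_def)

text \<open>Each step raises the coordinate sum by one. The sum thus acts as a clock that fixes the
  index of a cell and lets cells of different paths be compared.\<close>

lemma steps_nth_sum:
  assumes "successively dyck_step d" "k < length d"
  shows "fst (d ! k) + snd (d ! k) = fst (hd d) + snd (hd d) + k"
  using assms(2)
proof (induction k)
  case 0
  then show ?case by (simp add: hd_conv_nth)
next
  case (Suc k)
  then have "dyck_step (d ! k) (d ! Suc k)"
    using assms(1) by (auto simp: successively_iff_nth)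
  then show ?case using Suc by (auto simp: dyck_step_def)
qed

lemma steps_nth_mono:
  assumes "successively dyck_step d" "j \<le> k" "k < length d"
  shows "fst (d ! j) \<le> fst (d ! k) \<and> snd (d ! j) \<le> snd (d ! k)"
  using assms(2,3)
proof (induction k rule: dec_induct)
  case (step k)
  then have "dyck_step (d ! k) (d ! Suc k)"
    using assms(1) by (auto simp: successively_iff_nth)
  then show ?case using step by (auto simp: dyck_step_def)
qed simp

lemma steps_eqI:
  assumes "successively dyck_step d" "s \<in> set d" "t \<in> set d" "fst s + snd s = fst t + snd t"
  shows "s = t"
  using assms(2-4) steps_nth_sum[OF assms(1)] by (auto simp: in_set_conv_nth)

lemma steps_distinct:
  assumes "successively dyck_step d"
  shows "distinct d"
  unfolding distinct_conv_nth using steps_nth_sum[OF assms] by (metis add_left_cancel)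

lemma steps_comparable:
  assumes "successively dyck_step d" "s \<in> set d" "t \<in> set d"
  shows "fst s \<le> fst t \<and> snd s \<le> snd t \<or> fst t \<le> fst s \<and> snd t \<le> snd s"
proof -
  obtain j k where "j < length d" "d ! j = s" "k < length d" "d ! k = t"
    using assms(2,3) by (auto simp: in_set_conv_nth)
  then show ?thesis
    using steps_nth_mono[OF assms(1), of j k] steps_nth_mono[OF assms(1), of k j] by (cases "j \<le> k") auto
qed

lemma dyck_path_bounds:
  assumes "dyck_path n d" "s \<in> set d"
  shows "fst (hd d) \<le> fst s" "fst s \<le> fst (last d)" "snd (hd d) \<le> snd s" "snd s \<le> snd (last d)"
proof -
  have d: "d \<noteq> []" "successively dyck_step d" using assms(1) by (auto simp: dyck_path_iff)
  obtain k where k: "k < length d" "d ! k = s" using assms(2) by (auto simp: in_set_conv_nth)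
  show "fst (hd d) \<le> fst s" "snd (hd d) \<le> snd s"
    using steps_nth_mono[OF d(2), of 0 k] k d(1) by (auto simp: hd_conv_nth)
  show "fst s \<le> fst (last d)" "snd s \<le> snd (last d)"
    using steps_nth_mono[OF d(2), of k "length d - 1"] k d(1) by (auto simp: last_conv_nth)
qed

lemma dyck_path_length:
  assumes "dyck_path n d"
  shows "length d = 2 * (fst (last d) - fst (hd d)) + 1"
proof -
  have "d \<noteq> []" "successively dyck_step d" using assms by (auto simp: dyck_path_iff)
  then show ?thesis
    using steps_nth_sum[of d "length d - 1"] assms dyck_path_bounds(1)[OF assms, of "last d"]
    by (cases "length d") (auto simp: last_conv_nth dyck_path_iff)
qed

lemma dyck_path_ends_segments:
  assumes "dyck_path n d"
  shows "(fst (hd d), snd (last d)) \<in> segments n"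
proof -
  have "hd d \<in> set d" "last d \<in> set d" using assms by (auto simp: dyck_path_iff)
  moreover from this have "hd d \<in> segments n" "last d \<in> segments n"
    using assms by (auto simp: dyck_path_iff)
  ultimately show ?thesis
    using dyck_path_bounds[OF assms, of "last d"] assms by (auto simp: dyck_path_iff segments_iff)
qed

lemma finite_dyck_paths [simp]: "finite {d. dyck_path n d}"
  by (rule finite_subset[OF _ finite_subset_distinct[OF finite_segments[of n]]])
    (auto simp: dyck_path_iff steps_distinct)

lemma path_bound_eq:
  assumes "dyck_path n d"
  shows "path_bound a d = (\<Sum>k = fst (hd d)..<snd (last d). real (a k))"
  using assms by (simp add: path_bound_def dyck_path_iff atLeastLessThanSuc_atLeastAtMost)

lemma path_sum_eq_sum_set:
  assumes "dyck_path n d"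
  shows "path_sum x d = (\<Sum>s\<in>set d. Poly_Mapping.lookup x s)"
  using assms by (simp add: path_sum_def dyck_path_iff steps_distinct sum_list_distinct_conv_sum_set)

lemma path_sum_simps [simp]:
  "path_sum x [] = 0"
  "path_sum x (s # d) = Poly_Mapping.lookup x s + path_sum x d"
  "path_sum x (d @ d') = path_sum x d + path_sum x d'"
  by (simp_all add: path_sum_def)

lemma lookup_scaleR [simp]:
  "Poly_Mapping.lookup (r *\<^sub>R (x :: point)) s = r * Poly_Mapping.lookup x s"
proof -
  have "finite {i. r *\<^sub>R Poly_Mapping.lookup x i \<noteq> 0}"
    by (rule finite_subset[OF _ finite_keys[of x]]) (auto simp: in_keys_iff)
  then show ?thesis by (simp add: scaleR_poly_mapping_def)
qed

lemma path_sum_add [simp]: "path_sum (x + y) d = path_sum x d + path_sum y d"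
  by (induction d) (auto simp: lookup_add)

lemma path_sum_scaleR [simp]: "path_sum (r *\<^sub>R x) d = r * path_sum x d"
  by (induction d) (auto simp: algebra_simps)

lemma path_sum_diff [simp]: "path_sum (x - y) d = path_sum x d - path_sum y d"
  by (induction d) (auto simp: lookup_minus)

lemma linear_lookup: "linear (\<lambda>x :: point. Poly_Mapping.lookup x s)"
  by (rule linearI) (auto simp: lookup_add)

lemma linear_path_sum: "linear (\<lambda>x. path_sum x d)"
  by (rule linearI) auto

lemma dyck_path_swap:
  assumes "dyck_path n (p @ s # q)" "dyck_path n (p' @ s # q')"
  shows "dyck_path n (p @ s # q')"
  using assms by (auto simp: dyck_path_iff successively_append_iff successively_Cons hd_append)

text \<open>The bound is a function of the end minus a function of the start, by partial sums
  \<open>A\<close>; exchanging tails only permutes the ends.\<close>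

lemma dyck_path_swap_bound:
  assumes "dyck_path n (p @ s # q)" "dyck_path n (p' @ s # q')"
  shows "path_bound a (p @ s # q') + path_bound a (p' @ s # q)
       = path_bound a (p @ s # q) + path_bound a (p' @ s # q')"
proof -
  define A where "A k = (\<Sum>i<k. real (a i))" for k
  have A: "path_bound a d = A (snd (last d)) - A (fst (hd d))" if "dyck_path n d" for d
  proof -
    have "fst (hd d) \<le> snd (last d)" using dyck_path_ends_segments[OF that] by (simp add: segments_iff)
    then show ?thesis
      using sum_diff_nat_ivl[of 0 "fst (hd d)" "snd (last d)" "\<lambda>k. real (a k)"]
      by (simp add: path_bound_eq[OF that] A_def lessThan_atLeast0)
  qed
  note d = assms dyck_path_swap[OF assms] dyck_path_swap[OF assms(2,1)]
  show ?thesis unfolding d[THEN A] by (simp add: hd_append split: if_splits)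
qed

section \<open>Hooks: the paths along the first row and down the last column\<close>

lemma hook_nth:
  assumes "i < j" "k < 2 * (j - i) - 1"
  shows "hook i j ! k = (if k < j - i then (i, i + 1 + k) else (k + 2 * i + 1 - j, j))"
  using assms by (auto simp: hook_def nth_append simp del: upt_Suc)

lemma length_hook: "i < j \<Longrightarrow> length (hook i j) = 2 * (j - i) - 1"
  by (simp add: hook_def)

lemma hd_hook: "i < j \<Longrightarrow> hd (hook i j) = (i, i + 1)"
  by (subst hd_conv_nth) (auto simp: hook_nth length_hook simp flip: length_greater_0_conv)

lemma last_hook: "i < j \<Longrightarrow> last (hook i j) = (j - 1, j)"
  by (subst last_conv_nth) (auto simp: hook_nth length_hook simp flip: length_greater_0_conv)

lemma set_hook:
  "i < j \<Longrightarrow> set (hook i j) =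
    {s. fst s = i \<and> i < snd s \<and> snd s \<le> j \<or> snd s = j \<and> i \<le> fst s \<and> fst s < j}"
  by (auto simp: hook_def image_iff simp del: upt_Suc)

lemma dyck_path_hook:
  assumes "(i, j) \<in> segments n"
  shows "dyck_path n (hook i j)"
proof -
  have ij: "1 \<le> i" "i < j" "j \<le> n" using assms by (auto simp: segments_iff)
  have "successively dyck_step (hook i j)"
    unfolding successively_iff_nth
    using ij(2) by (auto simp: length_hook hook_nth dyck_step_def)
  moreover have "hook i j \<noteq> []" using ij(2) by (simp add: length_hook flip: length_greater_0_conv)
  moreover have "set (hook i j) \<subseteq> segments n" using ij by (auto simp: set_hook segments_iff)
  ultimately show ?thesis using ij by (simp add: dyck_path_iff hd_hook last_hook)
qed

lemma path_bound_hook: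
  "(i, j) \<in> segments n \<Longrightarrow> path_bound a (hook i j) = (\<Sum>k = i..<j. real (a k))"
  using path_bound_eq[OF dyck_path_hook] by (auto simp: hd_hook last_hook segments_iff)

text \<open>Monotonicity keeps the path in the first row up to this extreme cell and in the last
  column after it; the coordinate sums fix the remaining coordinate.\<close>

lemma dyck_path_eq_hook:
  assumes d: "dyck_path n d" and mem: "(fst (hd d), snd (last d)) \<in> set d"
  shows "d = hook (fst (hd d)) (snd (last d))"
proof -
  define i j where "i = fst (hd d)" and "j = snd (last d)"
  have st: "successively dyck_step d" and h: "snd (hd d) = i + 1" and l: "fst (last d) = j - 1"
    using d by (auto simp: dyck_path_iff i_def j_def)
  have ij: "i < j" using dyck_path_ends_segments[OF d] by (auto simp: segments_iff i_def j_def)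
  have len: "length d = 2 * (j - i) - 1"
    using dyck_path_length[OF d] ij l unfolding i_def[symmetric] by simp
  obtain m where m: "m < length d" "d ! m = (i, j)"
    using mem by (auto simp: in_set_conv_nth i_def j_def)
  have sum: "fst (d ! k) + snd (d ! k) = 2 * i + 1 + k" if "k < length d" for k
    using steps_nth_sum[OF st that] h by (simp add: i_def)
  have m_eq: "m = j - i - 1" using sum[OF m(1)] m(2) by simp
  have "d = hook i j"
  proof (rule nth_equalityI)
    show "length d = length (hook i j)" using len ij by (simp add: length_hook)
    fix k assume k: "k < length d"
    show "d ! k = hook i j ! k"
    proof (cases "k < j - i")
      case True
      then have "fst (d ! k) \<le> i" using steps_nth_mono[OF st, of k m] m m_eq by auto
      moreover have "i \<le> fst (d ! k)"
        using dyck_path_bounds(1)[OF d nth_mem[OF k]] by (simp add: i_def)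
      ultimately show ?thesis
        using sum[OF k] True k len ij by (auto simp: hook_nth prod_eq_iff)
    next
      case False
      then have "j \<le> snd (d ! k)" using steps_nth_mono[OF st, of m k] m m_eq k by auto
      moreover have "snd (d ! k) \<le> j"
        using dyck_path_bounds(4)[OF d nth_mem[OF k]] by (simp add: j_def)
      ultimately show ?thesis
        using sum[OF k] False k len ij by (auto simp: hook_nth prod_eq_iff)
    qed
  qed
  then show ?thesis by (simp add: i_def j_def)
qed

section \<open>Corners and non-crossing families\<close>

text \<open>Entered by a step to the right and left by a step down. Allowing \<open>p\<close> and
  \<open>q\<close> to be empty makes the only cell of a one-cell path an outer corner.\<close>

definition outer_corner :: "(nat \<times> nat) list \<Rightarrow> nat \<times> nat \<Rightarrow> bool" where
  "outer_corner d s \<longleftrightarrow>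
     (\<exists>p q. d = p @ s # q \<and> (p = [] \<or> s = (fst (last p), snd (last p) + 1)) \<and>
        (q = [] \<or> hd q = (fst s + 1, snd s)))"

definition inner_corner :: "(nat \<times> nat) list \<Rightarrow> nat \<times> nat \<Rightarrow> bool" where
  "inner_corner d s \<longleftrightarrow>
     (\<exists>p q. d = p @ s # q \<and> p \<noteq> [] \<and> q \<noteq> [] \<and> s = (fst (last p) + 1, snd (last p)) \<and>
        hd q = (fst s, snd s + 1))"

lemma outer_corner_iff_nth:
  "outer_corner d s \<longleftrightarrow>
     (\<exists>k<length d. d ! k = s \<and> (k = 0 \<or> s = (fst (d ! (k - 1)), snd (d ! (k - 1)) + 1)) \<and>
        (Suc k = length d \<or> d ! Suc k = (fst s + 1, snd s)))"
proof
  assume "outer_corner d s"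
  then obtain p q where d: "d = p @ s # q" "p = [] \<or> s = (fst (last p), snd (last p) + 1)"
    "q = [] \<or> hd q = (fst s + 1, snd s)" by (auto simp: outer_corner_def)
  have "p \<noteq> [] \<Longrightarrow> d ! (length p - 1) = last p"
    using d(1) by (simp add: nth_append last_conv_nth)
  moreover have "q \<noteq> [] \<Longrightarrow> d ! Suc (length p) = hd q"
    using d(1) by (simp add: nth_append hd_conv_nth)
  ultimately show "\<exists>k<length d. d ! k = s \<and> (k = 0 \<or> s = (fst (d ! (k - 1)), snd (d ! (k - 1)) + 1)) \<and>
        (Suc k = length d \<or> d ! Suc k = (fst s + 1, snd s))"
    using d by (intro exI[of _ "length p"]) (cases "p = []"; cases "q = []"; simp)
next
  assume "\<exists>k<length d. d ! k = s \<and> (k = 0 \<or> s = (fst (d ! (k - 1)), snd (d ! (k - 1)) + 1)) \<and>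
        (Suc k = length d \<or> d ! Suc k = (fst s + 1, snd s))"
  then obtain k where k: "k < length d" "d ! k = s"
    "k = 0 \<or> s = (fst (d ! (k - 1)), snd (d ! (k - 1)) + 1)"
    "Suc k = length d \<or> d ! Suc k = (fst s + 1, snd s)" by blast
  have "take k d = [] \<or> last (take k d) = d ! (k - 1)"
    using k(1) by (cases "take k d = []") (simp_all add: last_conv_nth)
  then have "take k d = [] \<or> s = (fst (last (take k d)), snd (last (take k d)) + 1)"
    using k(3) by (cases "k = 0") auto
  moreover have "drop (Suc k) d = [] \<or> hd (drop (Suc k) d) = d ! Suc k"
    using hd_drop_conv_nth[of "Suc k" d] by (cases "Suc k < length d") auto
  then have "drop (Suc k) d = [] \<or> hd (drop (Suc k) d) = (fst s + 1, snd s)"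
    using k(4) by auto
  moreover have "d = take k d @ s # drop (Suc k) d"
    using id_take_nth_drop[OF k(1)] k(2) by simp
  ultimately show "outer_corner d s" unfolding outer_corner_def by blast
qed

text \<open>After the last cell \<open>d ! m\<close> in the first row the path goes down. A later
  step to the right would create an inner corner, so the column never changes again and
  \<open>d ! m\<close> is the extreme cell of a hook.\<close>

lemma dyck_path_without_inner_corner:
  assumes d: "dyck_path n d" and no: "\<And>s. \<not> inner_corner d s"
  shows "d = hook (fst (hd d)) (snd (last d))"
proof (rule dyck_path_eq_hook[OF d])
  have st: "successively dyck_step d" and ne: "d \<noteq> []" using d by (auto simp: dyck_path_iff)
  let ?S = "{k. k < length d \<and> fst (d ! k) = fst (hd d)}"
  have S: "finite ?S" "?S \<noteq> {}" using ne by (auto simp: hd_conv_nth intro!: exI[of _ 0])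
  define m where "m = Max ?S"
  have m: "m < length d" "fst (d ! m) = fst (hd d)" using Max_in[OF S] by (auto simp: m_def)
  have max: "fst (d ! k) \<noteq> fst (hd d)" if "m < k" "k < length d" for k
  proof
    assume "fst (d ! k) = fst (hd d)"
    then have "k \<le> m" using that(2) S(1) unfolding m_def by (intro Max_ge) auto
    then show False using that(1) by simp
  qed
  have down: "Suc k < length d \<longrightarrow> d ! Suc k = (fst (d ! k) + 1, snd (d ! k))" if "m \<le> k" for k
    using that
  proof (induction k rule: dec_induct)
    case base
    then show ?case
    proof
      assume l: "Suc m < length d"
      then have "dyck_step (d ! m) (d ! Suc m)" using st by (auto simp: successively_iff_nth)
      then show "d ! Suc m = (fst (d ! m) + 1, snd (d ! m))"
        using max[of "Suc m"] l m(2) by (auto simp: dyck_step_def)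
    qed
  next
    case (step k)
    show ?case
    proof
      assume l: "Suc (Suc k) < length d"
      then have "dyck_step (d ! Suc k) (d ! Suc (Suc k))" using st by (auto simp: successively_iff_nth)
      moreover have "d ! Suc (Suc k) \<noteq> (fst (d ! Suc k), snd (d ! Suc k) + 1)"
      proof
        assume right: "d ! Suc (Suc k) = (fst (d ! Suc k), snd (d ! Suc k) + 1)"
        have "d ! Suc k = (fst (last (take (Suc k) d)) + 1, snd (last (take (Suc k) d)))"
          using l step.IH by (simp add: take_Suc_conv_app_nth)
        moreover have "hd (drop (Suc (Suc k)) d) = (fst (d ! Suc k), snd (d ! Suc k) + 1)"
          using l right by (simp add: hd_drop_conv_nth)
        moreover have "d = take (Suc k) d @ d ! Suc k # drop (Suc (Suc k)) d"
          using l by (intro id_take_nth_drop) simp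
        moreover have "take (Suc k) d \<noteq> []" "drop (Suc (Suc k)) d \<noteq> []" using l by auto
        ultimately have "inner_corner d (d ! Suc k)" unfolding inner_corner_def by blast
        then show False using no by blast
      qed
      ultimately show "d ! Suc (Suc k) = (fst (d ! Suc k) + 1, snd (d ! Suc k))"
        by (auto simp: dyck_step_def)
    qed
  qed
  have flat: "k < length d \<longrightarrow> snd (d ! k) = snd (d ! m)" if "m \<le> k" for k
    using that
  proof (induction k rule: dec_induct)
    case (step k)
    then show ?case using down[of k] by (metis Suc_lessD less_imp_le snd_conv)
  qed simp
  have "snd (last d) = snd (d ! m)"
    using flat[of "length d - 1"] m(1) ne by (simp add: last_conv_nth)
  then have "(fst (hd d), snd (last d)) = d ! m" using m(2) by (simp add: prod_eq_iff)
  then show "(fst (hd d), snd (last d)) \<in> set d" using m(1) by simp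
qed

lemma outer_corner_hook:
  assumes "i < j" "outer_corner (hook i j) s"
  shows "s = (i, j)"
proof -
  obtain k where k: "k < length (hook i j)" "hook i j ! k = s"
    "k = 0 \<or> s = (fst (hook i j ! (k - 1)), snd (hook i j ! (k - 1)) + 1)"
    "Suc k = length (hook i j) \<or> hook i j ! Suc k = (fst s + 1, snd s)"
    using assms(2) by (auto simp: outer_corner_iff_nth)
  note [simp] = length_hook[OF assms(1)] hook_nth[OF assms(1)]
  have "\<not> Suc k < j - i"
  proof
    assume "Suc k < j - i"
    then show False using k(1,4) k(2)[symmetric] by auto
  qed
  moreover have "\<not> j - i \<le> k"
  proof
    assume "j - i \<le> k"
    then show False using k(1,3) k(2)[symmetric] assms(1) by (auto split: if_splits)
  qed
  ultimately have "k = j - i - 1" by simp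
  then show ?thesis using k(1,2) assms(1) by auto
qed

text \<open>The exchange property: exchanging tails at a common cell gives back the same two
  paths.\<close>

definition noncrossing :: "'a list set \<Rightarrow> bool" where
  "noncrossing F \<longleftrightarrow> (\<forall>p s q p' q'. p @ s # q \<in> F \<and> p' @ s # q' \<in> F \<longrightarrow> p = p' \<or> q = q')"

lemma noncrossing_nth:
  assumes "noncrossing F" "d \<in> F" "d' \<in> F" "k < length d" "k' < length d'" "d ! k = d' ! k'"
  shows "take k d = take k' d' \<or> drop (Suc k) d = drop (Suc k') d'"
proof -
  have "take k d @ d ! k # drop (Suc k) d \<in> F" "take k' d' @ d ! k # drop (Suc k') d' \<in> F"
    using assms id_take_nth_drop[of k d] id_take_nth_drop[of k' d'] by simp_all
  then show ?thesis using assms(1) unfolding noncrossing_def by blast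
qed

text \<open>Used against lexicographic maximality: after a common piece, the path that moves to a
  larger column, or goes on where the other stops, is the larger one.\<close>

lemma map_snd_less_append:
  fixes p q q' :: "(nat \<times> nat) list"
  shows "q' \<noteq> [] \<Longrightarrow> q = [] \<or> snd (hd q) < snd (hd q') \<Longrightarrow> map snd (p @ q) < map snd (p @ q')"
  by (induction p) (cases q; cases q'; auto)+

text \<open>Among the paths of \<open>F\<close> with the leftmost start, the lexicographically largest one lies weakly above
  every other path of \<open>F\<close>. It therefore leaves each common initial piece with a step to the right
  and enters each common final piece with a step down, and has a private corner in between.\<close>

lemma noncrossing_topmost_path:
  assumes F: "finite F" "F \<noteq> {}" "\<And>d. d \<in> F \<Longrightarrow> dyck_path n d" and nc: "noncrossing F"
  obtains d where "d \<in> F"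
    "\<And>d'. d' \<in> F \<Longrightarrow> fst (hd d) \<le> fst (hd d')"
    "\<And>d' k. \<lbrakk>d' \<in> F; d' \<noteq> d; k < length d; k < length d'; take (Suc k) d = take (Suc k) d';
        \<not> (Suc k < length d \<and> Suc k < length d' \<and> d ! Suc k = d' ! Suc k)\<rbrakk> \<Longrightarrow>
        Suc k < length d \<and> d ! Suc k = (fst (d ! k), snd (d ! k) + 1)"
    "\<And>d' k. \<lbrakk>d' \<in> F; k < length d'; k + 2 * (fst (hd d') - fst (hd d)) < length d\<rbrakk> \<Longrightarrow>
        snd (d' ! k) \<le> snd (d ! (k + 2 * (fst (hd d') - fst (hd d))))"
proof -
  define i where "i = Min ((fst \<circ> hd) ` F)"
  have i_le: "i \<le> fst (hd d)" if "d \<in> F" for d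
    unfolding i_def using F(1) that by (intro Min_le) auto
  define F0 where "F0 = {d \<in> F. fst (hd d) = i}"
  have "i \<in> (fst \<circ> hd) ` F" unfolding i_def using F(1,2) by (intro Min_in) auto
  then have F0: "finite (map snd ` F0)" "map snd ` F0 \<noteq> {}" using F(1) by (auto simp: F0_def)
  obtain d where d0: "d \<in> F0" and d_Max: "map snd d = Max (map snd ` F0)"
    using Max_in[OF F0] by (metis imageE)
  have d: "d \<in> F" "fst (hd d) = i" using d0 by (auto simp: F0_def)
  have max: "\<not> map snd d < map snd d'" if "d' \<in> F0" for d'
    using Max_ge[OF F0(1), of "map snd d'"] that d_Max by (auto simp: not_less)
  have dp: "dyck_path n d" and st: "successively dyck_step d" and ne: "d \<noteq> []"
    using F(3)[OF d(1)] by (auto simp: dyck_path_iff)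
  have step: "dyck_step (d ! k) (d ! Suc k)" if "Suc k < length d" for k
    using st that by (auto simp: successively_iff_nth)
  have diverge: "Suc k < length d \<and> d ! Suc k = (fst (d ! k), snd (d ! k) + 1)"
    if "d' \<in> F" "d' \<noteq> d" "k < length d" "k < length d'" "take (Suc k) d = take (Suc k) d'"
      "\<not> (Suc k < length d \<and> Suc k < length d' \<and> d ! Suc k = d' ! Suc k)" for d' k
  proof -
    have dp': "dyck_path n d'" and st': "successively dyck_step d'"
      using F(3)[OF that(1)] by (auto simp: dyck_path_iff)
    have eq: "d ! k = d' ! k" using that(5) by (metis lessI nth_take)
    have "hd d = hd d'" using that(5) ne by (metis Zero_not_Suc hd_take zero_less_Suc)
    then have F0': "d' \<in> F0" using that(1) d by (simp add: F0_def)
    have split: "d = take (Suc k) d @ drop (Suc k) d" "d' = take (Suc k) d @ drop (Suc k) d'"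
      using that(5) by (metis append_take_drop_id)+
    have not_less: "drop (Suc k) d' = [] \<or> drop (Suc k) d \<noteq> [] \<and>
        snd (hd (drop (Suc k) d')) \<le> snd (hd (drop (Suc k) d))"
      using max[OF F0'] map_snd_less_append[of "drop (Suc k) d'" "drop (Suc k) d" "take (Suc k) d"]
      by (metis split not_less)
    have lt: "Suc k < length d"
    proof (rule ccontr)
      assume "\<not> Suc k < length d"
      then have "drop (Suc k) d = []" "drop (Suc k) d' = []" using not_less by auto
      then show False using split that(2) by simp
    qed
    show ?thesis
    proof (cases "Suc k < length d'")
      case True
      then have "dyck_step (d' ! k) (d' ! Suc k)" using st' by (auto simp: successively_iff_nth)
      moreover have "snd (d' ! Suc k) \<le> snd (d ! Suc k)"
        using not_less True lt by (simp add: hd_drop_conv_nth)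
      ultimately show ?thesis
        using step[OF lt] eq that(6) True lt by (auto simp: dyck_step_def)
    next
      case False
      \<comment> \<open>Here \<open>d'\<close> ends in a cell next to the diagonal, from which
        \<open>d\<close> can only continue to the right.\<close>
      then have "d' ! k = last d'" using that(4)
        by (metis Suc_lessI diff_Suc_1 last_conv_nth length_0_conv not_less_zero)
      then have "snd (d ! k) = fst (d ! k) + 1" using dp' eq by (simp add: dyck_path_iff)
      moreover have "d ! Suc k \<in> segments n" using dp lt by (auto simp: dyck_path_iff)
      ultimately show ?thesis using step[OF lt] lt by (auto simp: dyck_step_def segments_iff)
    qed
  qed
  have above: "snd (d' ! k1) \<le> snd (d ! (k1 + 2 * (fst (hd d') - fst (hd d))))"
    if d': "d' \<in> F" "k1 < length d'" "k1 + 2 * (fst (hd d') - fst (hd d)) < length d" for d' k1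
  proof (rule ccontr)
    \<comment> \<open>Cell \<open>k\<close> of \<open>d'\<close> and cell \<open>k + o'\<close> of
      \<open>d\<close> have the same coordinate sum. The column gap \<open>g\<close> changes by at
      most one per step, so it cannot become positive without passing through a common cell.\<close>
    define o' where "o' = 2 * (fst (hd d') - fst (hd d))"
    define g where "g k = int (snd (d' ! k)) - int (snd (d ! (k + o')))" for k
    assume "\<not> ?thesis"
    then have g1: "0 < g k1" by (simp add: g_def o'_def)
    have dp': "dyck_path n d'" and st': "successively dyck_step d'" and ne': "d' \<noteq> []"
      using F(3)[OF d'(1)] by (auto simp: dyck_path_iff)
    have lens: "k < length d'" "k + o' < length d" if "k \<le> k1" for k
      using d'(2,3) that by (auto simp: o'_def)
    have g_step: "\<bar>g (Suc k) - g k\<bar> \<le> 1" if "k < k1" for k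
    proof -
      have "dyck_step (d' ! k) (d' ! Suc k)" using st' lens[of "Suc k"] that by (auto simp: successively_iff_nth)
      moreover have "dyck_step (d ! (k + o')) (d ! (Suc k + o'))"
        using step[of "k + o'"] lens[of "Suc k"] that by simp
      ultimately show ?thesis by (auto simp: g_def dyck_step_def)
    qed
    have sums: "fst (d ! (k + o')) + snd (d ! (k + o')) = fst (d' ! k) + snd (d' ! k)" if "k \<le> k1" for k
      using steps_nth_sum[OF st lens(2)[OF that]] steps_nth_sum[OF st' lens(1)[OF that]]
        dp dp' i_le[OF d'(1)] d(2) by (simp add: dyck_path_iff o'_def)
    have zero: "d ! (k + o') = d' ! k" if "k \<le> k1" "g k = 0" for k
      using sums[OF that(1)] that(2) by (auto simp: g_def prod_eq_iff)
    \<comment> \<open>The first cell of \<open>d'\<close> lies next to the diagonal, so it has the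
      least column among segments with its coordinate sum.\<close>
    have g0: "g 0 \<le> 0"
    proof -
      have "d ! o' \<in> segments n" using dp lens(2)[of 0] by (auto simp: dyck_path_iff)
      then show ?thesis using sums[of 0] dp' ne' by (auto simp: g_def segments_iff dyck_path_iff hd_conv_nth)
    qed
    let ?Z = "{k. k \<le> k1 \<and> g k = 0}"
    have "\<exists>k. 0 \<le> k \<and> k \<le> k1 \<and> g k = 0"
      using g_step g0 g1 by (intro nat_intermed_int_val) auto
    then have Z: "finite ?Z" "?Z \<noteq> {}" by auto
    \<comment> \<open>The last common cell before \<open>k1\<close>. Agreement after it contradicts
      the gap at \<open>k1\<close>; agreement before it makes \<open>d\<close> leave to the right,
      which yields a later common cell.\<close>
    define m where "m = Max ?Z"
    have m: "m \<le> k1" "g m = 0" using Max_in[OF Z] by (auto simp: m_def)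
    have m_max: "k \<le> m" if "k \<le> k1" "g k = 0" for k
      unfolding m_def using that Z(1) by (intro Max_ge) auto
    have mk: "m < k1" using m g1 by (metis le_neq_implies_less less_irrefl)
    have eq: "d ! (m + o') = d' ! m" using zero m by simp
    have "take (m + o') d = take m d' \<or> drop (Suc (m + o')) d = drop (Suc m) d'"
      using noncrossing_nth[OF nc d(1) d'(1) lens(2)[OF m(1)] lens(1)[OF m(1)] eq] .
    then show False
    proof
      assume "drop (Suc (m + o')) d = drop (Suc m) d'"
      then have "drop (Suc (m + o')) d ! (k1 - Suc m) = drop (Suc m) d' ! (k1 - Suc m)" by simp
      then have "d ! (k1 + o') = d' ! k1" using mk lens[of k1] by (simp add: nth_drop add.commute)
      then show False using g1 by (simp add: g_def)
    next
      assume pre: "take (m + o') d = take m d'"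
      then have "o' = 0" using lens[OF m(1)] by (metis add_cancel_left_right length_take less_imp_le min.absorb2)
      then have pre': "take (Suc m) d = take (Suc m) d'" and lt: "m < length d" "m < length d'"
        using pre eq lens[OF m(1)] by (simp_all add: take_Suc_conv_app_nth)
      have lt': "Suc m < length d" "Suc m < length d'" using lens[of "Suc m"] mk \<open>o' = 0\<close> by auto
      have neq: "d ! Suc m \<noteq> d' ! Suc m"
        using m_max[of "Suc m"] mk \<open>o' = 0\<close> by (auto simp: g_def)
      then have "d' \<noteq> d" by auto
      from diverge[OF d'(1) this lt pre'] neq
      have "d ! Suc m = (fst (d ! m), snd (d ! m) + 1)" by simp
      moreover have "dyck_step (d' ! m) (d' ! Suc m)" using st' lt' by (auto simp: successively_iff_nth)
      ultimately have "g (Suc m) \<le> 0" using eq \<open>o' = 0\<close> by (auto simp: g_def dyck_step_def)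
      then have "\<exists>k. Suc m \<le> k \<and> k \<le> k1 \<and> g k = 0"
        using g_step g1 mk by (intro nat_intermed_int_val) auto
      then show False using m_max by force
    qed
  qed
  show thesis
  proof (rule that[of d])
    show "fst (hd d) \<le> fst (hd d')" if "d' \<in> F" for d' using i_le[OF that] d(2) by simp
  qed (use d(1) diverge above in blast)+
qed

text \<open>By the exchange property, each cell that the topmost path shares with another path has
  its index in a common initial piece (\<open>K\<close>) or a common final piece (\<open>B\<close>).
  Between these, from \<open>L\<close> up to but excluding \<open>U\<close>, all cells are private.
  The cell at \<open>L\<close> is entered from the left or starts the path, while \<open>U\<close>
  is entered from above or ends the path, so a right step is followed by a down step in
  between.\<close>

lemma noncrossing_private_corner:
  assumes F: "finite F" "F \<noteq> {}" "\<And>d. d \<in> F \<Longrightarrow> dyck_path n d" and nc: "noncrossing F"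
  obtains d s where "d \<in> F" "outer_corner d s" "\<And>d'. d' \<in> F \<Longrightarrow> s \<in> set d' \<Longrightarrow> d' = d"
proof -
  obtain d where d: "d \<in> F" and start: "\<And>d'. d' \<in> F \<Longrightarrow> fst (hd d) \<le> fst (hd d')"
    and diverge: "\<And>d' k. \<lbrakk>d' \<in> F; d' \<noteq> d; k < length d; k < length d'; take (Suc k) d = take (Suc k) d';
        \<not> (Suc k < length d \<and> Suc k < length d' \<and> d ! Suc k = d' ! Suc k)\<rbrakk> \<Longrightarrow>
        Suc k < length d \<and> d ! Suc k = (fst (d ! k), snd (d ! k) + 1)"
    and above: "\<And>d' k. \<lbrakk>d' \<in> F; k < length d'; k + 2 * (fst (hd d') - fst (hd d)) < length d\<rbrakk> \<Longrightarrow>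
        snd (d' ! k) \<le> snd (d ! (k + 2 * (fst (hd d') - fst (hd d))))"
    using noncrossing_topmost_path[OF F nc] by blast
  have dp: "dyck_path n d" and st: "successively dyck_step d" and ne: "d \<noteq> []"
    using F(3)[OF d] by (auto simp: dyck_path_iff)
  have step: "dyck_step (d ! k) (d ! Suc k)" if "Suc k < length d" for k
    using st that by (auto simp: successively_iff_nth)
  define K where "K = {k. k < length d \<and>
    (\<exists>d'\<in>F. d' \<noteq> d \<and> k < length d' \<and> take (Suc k) d = take (Suc k) d')}"
  define B where "B = {k. k < length d \<and>
    (\<exists>d'\<in>F. d' \<noteq> d \<and> (\<exists>k'<length d'. drop k d = drop k' d'))}"
  have fin: "finite K" "finite B" by (auto simp: K_def B_def)
  have B_up: "k \<in> B" if b: "b \<in> B" "b \<le> k" "k < length d" for b k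
  proof -
    obtain d' k' where d': "d' \<in> F" "d' \<noteq> d" "k' < length d'" "drop b d = drop k' d'"
      using b(1) by (auto simp: B_def)
    from d'(4) have "length d - b = length d' - k'" by (metis length_drop)
    moreover have "drop k d = drop (k' + (k - b)) d'"
      using arg_cong[OF d'(4), of "drop (k - b)"] b(2) by (simp add: add.commute)
    ultimately show ?thesis using d' b by (auto simp: B_def intro!: exI[of _ "k' + (k - b)"])
  qed
  \<comment> \<open>If \<open>d\<close> shares its beginning with \<open>d1\<close> and its end with
    \<open>d2\<close>, both through cell \<open>k\<close>, the exchange property for
    \<open>d1\<close> and \<open>d2\<close> makes one of them equal to \<open>d\<close>.\<close>
  have disj: "k \<notin> B" if k: "k \<in> K" for k
  proof
    assume "k \<in> B"
    obtain d1 where d1: "d1 \<in> F" "d1 \<noteq> d" "k < length d1" "take (Suc k) d = take (Suc k) d1"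
      using k by (auto simp: K_def)
    obtain d2 k2 where d2: "d2 \<in> F" "d2 \<noteq> d" "k2 < length d2" "drop k d = drop k2 d2"
      using \<open>k \<in> B\<close> by (auto simp: B_def)
    have lt: "k < length d" using k by (simp add: K_def)
    have e1: "d ! k = d1 ! k" "take k d = take k d1"
      using d1(3,4) lt by (auto simp: take_Suc_conv_app_nth)
    have e2: "d ! k = d2 ! k2" "drop (Suc k) d = drop (Suc k2) d2"
      using d2(3,4) lt by (auto simp: Cons_nth_drop_Suc[symmetric])
    have "take k d1 = take k2 d2 \<or> drop (Suc k) d1 = drop (Suc k2) d2"
      using noncrossing_nth[OF nc d1(1) d2(1) d1(3) d2(3)] e1 e2 by simp
    then show False
    proof
      assume "take k d1 = take k2 d2"
      then have "d = d2" using e1(2) d2(4) by (metis append_take_drop_id)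
      then show False using d2(2) by simp
    next
      assume "drop (Suc k) d1 = drop (Suc k2) d2"
      then have "d = d1" using e2(2) d1(4) by (metis append_take_drop_id)
      then show False using d1(2) by simp
    qed
  qed
  define L where "L = (if K = {} then 0 else Suc (Max K))"
  have L: "L < length d" "L = 0 \<or> d ! L = (fst (d ! (L - 1)), snd (d ! (L - 1)) + 1)"
  proof -
    have "L < length d \<and> d ! L = (fst (d ! (L - 1)), snd (d ! (L - 1)) + 1)" if "K \<noteq> {}"
    proof -
      have L: "L = Suc (Max K)" using that by (simp add: L_def)
      have "Max K \<in> K" using fin(1) that by simp
      then obtain d' where d': "d' \<in> F" "d' \<noteq> d" "Max K < length d'" "Max K < length d"
          "take L d = take L d'" by (auto simp: K_def L)
      have "\<not> (L < length d \<and> L < length d' \<and> d ! L = d' ! L)"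
      proof
        assume "L < length d \<and> L < length d' \<and> d ! L = d' ! L"
        then have "L \<in> K" using d' by (auto simp: K_def take_Suc_conv_app_nth intro!: bexI[of _ d'])
        then show False using Max_ge[OF fin(1), of L] L by simp
      qed
      then show ?thesis using diverge[OF d'(1,2,4,3)] d'(5) by (simp add: L)
    qed
    then show "L < length d" "L = 0 \<or> d ! L = (fst (d ! (L - 1)), snd (d ! (L - 1)) + 1)"
      using ne by (auto simp: L_def)
  qed
  define U where "U = (if B = {} then length d else Min B)"
  have U: "0 < U" "U \<le> length d"
    "U = length d \<or> d ! U = (fst (d ! (U - 1)) + 1, snd (d ! (U - 1)))"
  proof -
    have "0 < U \<and> U < length d \<and> d ! U = (fst (d ! (U - 1)) + 1, snd (d ! (U - 1)))" if "B \<noteq> {}"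
    proof -
      have U: "U = Min B" using that by (simp add: U_def)
      have UB: "U \<in> B" using fin(2) that by (simp add: U)
      then obtain d' k' where d': "d' \<in> F" "d' \<noteq> d" "k' < length d'" "U < length d"
          "drop U d = drop k' d'" by (auto simp: B_def)
      have dp': "dyck_path n d'" and st': "successively dyck_step d'" and ne': "d' \<noteq> []"
        using F(3)[OF d'(1)] by (auto simp: dyck_path_iff)
      have e: "d ! U = d' ! k'" using d'(3-5) by (auto simp: Cons_nth_drop_Suc[symmetric])
      define o' where "o' = 2 * (fst (hd d') - fst (hd d))"
      have Uk: "U = k' + o'"
        using steps_nth_sum[OF st d'(4)] steps_nth_sum[OF st' d'(3)] e dp dp' start[OF d'(1)]
        by (simp add: dyck_path_iff o'_def)
      have "0 < U"
      proof (rule ccontr)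
        assume "\<not> 0 < U"
        then have "d = d'" using d'(5) Uk by simp
        then show False using d'(2) by simp
      qed
      then have stepU: "dyck_step (d ! (U - 1)) (d ! U)" using step[of "U - 1"] d'(4) by simp
      \<comment> \<open>Since \<open>d'\<close> lies weakly below \<open>d\<close>, it would have to
        enter the cell by the same right step, extending the common final piece below its least
        index. If \<open>d'\<close> starts here, the cell to the left is on the diagonal.\<close>
      have "d ! U \<noteq> (fst (d ! (U - 1)), snd (d ! (U - 1)) + 1)"
      proof
        assume right: "d ! U = (fst (d ! (U - 1)), snd (d ! (U - 1)) + 1)"
        show False
        proof (cases k')
          case 0
          then have "snd (d ! U) = fst (d ! U) + 1"
            using e dp' ne' by (simp add: dyck_path_iff hd_conv_nth)
          moreover have "d ! (U - 1) \<in> segments n" using dp d'(4) by (auto simp: dyck_path_iff)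
          ultimately show False using right by (auto simp: segments_iff)
        next
          case (Suc m)
          have U1: "U - 1 = m + o'" using Uk Suc by simp
          have "snd (d' ! m) \<le> snd (d ! (U - 1))"
            using above[OF d'(1), of m] d'(3,4) Suc U1 Uk by (simp add: o'_def)
          moreover have "dyck_step (d' ! m) (d' ! k')"
            using st' d'(3) Suc by (auto simp: successively_iff_nth)
          ultimately have "d' ! m = d ! (U - 1)"
            using right e by (auto simp: dyck_step_def prod_eq_iff)
          then have "drop (U - 1) d = drop m d'"
            using d'(3-5) Suc \<open>0 < U\<close> by (simp add: Cons_nth_drop_Suc[symmetric])
          then have "U - 1 \<in> B" using d' Suc by (auto simp: B_def intro!: bexI[of _ d'] exI[of _ m])
          then show False using Min_le[OF fin(2), of "U - 1"] U \<open>0 < U\<close> by simp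
        qed
      qed
      then show ?thesis using stepU \<open>0 < U\<close> d'(4) by (auto simp: dyck_step_def)
    qed
    moreover have "U = length d" if "B = {}" using that by (simp add: U_def)
    ultimately show "0 < U" "U \<le> length d"
        "U = length d \<or> d ! U = (fst (d ! (U - 1)) + 1, snd (d ! (U - 1)))"
      using ne by (cases "B = {}"; simp)+
  qed
  have "L < U"
  proof (cases "K = {} \<or> B = {}")
    case True
    then have "L = 0 \<or> U = length d" by (auto simp: L_def U_def)
    then show ?thesis using L(1) U(1) by auto
  next
    case False
    then have LU: "L = Suc (Max K)" "U = Min B" by (auto simp: L_def U_def)
    have "Max K \<in> K" "Min B \<in> B" using False fin by auto
    then have "\<not> U \<le> Max K" using B_up[of U "Max K"] disj[of "Max K"] LU by (auto simp: K_def)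
    moreover have "L \<noteq> U"
    proof
      assume eq: "L = U"
      have "d ! L = (fst (d ! (L - 1)), snd (d ! (L - 1)) + 1)" using L LU by auto
      moreover have "d ! U = (fst (d ! (U - 1)) + 1, snd (d ! (U - 1)))" using U L eq by auto
      ultimately show False using eq by simp
    qed
    ultimately show ?thesis using LU by simp
  qed
  \<comment> \<open>The last index in the private range entered by a right step, or 0, is sought;
    \<open>L\<close> is a candidate, and maximality makes the next step go down.\<close>
  let ?R = "{k. L \<le> k \<and> k < U \<and> (k = 0 \<or> d ! k = (fst (d ! (k - 1)), snd (d ! (k - 1)) + 1))}"
  have R: "finite ?R" "?R \<noteq> {}" using L(2) \<open>L < U\<close> by auto
  define m where "m = Max ?R"
  have m: "L \<le> m" "m < U" "m = 0 \<or> d ! m = (fst (d ! (m - 1)), snd (d ! (m - 1)) + 1)"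
    using Max_in[OF R] by (auto simp: m_def)
  have m_lt: "m < length d" using m(2) U(2) by simp
  have "Suc m = length d \<or> d ! Suc m = (fst (d ! m) + 1, snd (d ! m))"
  proof (cases "Suc m = U")
    case True
    then show ?thesis using U(3) by auto
  next
    case False
    then have lt: "Suc m < U" using m(2) by simp
    have "Suc m \<notin> ?R"
    proof
      assume "Suc m \<in> ?R"
      then have "Suc m \<le> m" unfolding m_def by (rule Max_ge[OF R(1)])
      then show False by simp
    qed
    then show ?thesis using step[of m] lt U(2) m(1) by (auto simp: dyck_step_def)
  qed
  then have "outer_corner d (d ! m)" using m(3) m_lt by (auto simp: outer_corner_iff_nth)
  moreover have "d' = d" if d': "d' \<in> F" "d ! m \<in> set d'" for d'
  proof (rule ccontr)
    assume neq: "d' \<noteq> d"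
    obtain k' where k': "k' < length d'" "d' ! k' = d ! m" using d'(2) by (auto simp: in_set_conv_nth)
    have "take m d = take k' d' \<or> drop (Suc m) d = drop (Suc k') d'"
      using noncrossing_nth[OF nc d d'(1) m_lt k'(1)] k'(2) by simp
    then show False
    proof
      assume pre: "take m d = take k' d'"
      then have "length (take m d) = length (take k' d')" by simp
      then have "k' = m" using m_lt k'(1) by simp
      then have "m \<in> K" using d'(1) neq k' pre m_lt
        by (auto simp: K_def take_Suc_conv_app_nth intro!: bexI[of _ d'])
      then have "K \<noteq> {}" "m \<le> Max K" using fin(1) by auto
      then show False using m(1) by (simp add: L_def)
    next
      assume "drop (Suc m) d = drop (Suc k') d'"
      then have "drop m d = drop k' d'" using k' m_lt by (simp add: Cons_nth_drop_Suc[symmetric])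
      then have "m \<in> B" using d'(1) neq k' m_lt by (auto simp: B_def)
      then have "B \<noteq> {}" "Min B \<le> m" using fin(2) by auto
      then show False using m(2) by (simp add: U_def)
    qed
  qed
  ultimately show thesis using that[OF d] by blast
qed

lemma outer_corner_in_set: "outer_corner d s \<Longrightarrow> s \<in> set d"
  by (auto simp: outer_corner_def)

text \<open>A path with a private corner is removed and the rest treated by induction; no remaining
  path contains that corner, so it is a fresh value.\<close>

lemma noncrossing_corner_injection:
  assumes "finite F" "\<And>d. d \<in> F \<Longrightarrow> dyck_path n d" "noncrossing F"
  shows "\<exists>f. inj_on f F \<and> (\<forall>d\<in>F. outer_corner d (f d))"
  using assms
proof (induction F rule: finite_psubset_induct)
  case (psubset F)
  show ?case
  proof (cases "F = {}")
    case False
    obtain d s where d: "d \<in> F" "outer_corner d s" "\<And>d'. d' \<in> F \<Longrightarrow> s \<in> set d' \<Longrightarrow> d' = d"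
      using noncrossing_private_corner[OF psubset.hyps(1) False psubset.prems] by blast
    have "noncrossing (F - {d})" using psubset.prems(2) unfolding noncrossing_def by blast
    then obtain f where f: "inj_on f (F - {d})" "\<forall>d'\<in>F - {d}. outer_corner d' (f d')"
      using psubset.IH[of "F - {d}"] psubset.prems(1) d(1) by blast
    have "f d' \<noteq> s" if "d' \<in> F - {d}" for d'
    proof -
      have "f d' \<in> set d'" using f(2) that outer_corner_in_set by blast
      then show ?thesis using d(3) that by blast
    qed
    then have "inj_on (f(d := s)) F" using f(1) by (auto simp: inj_on_def)
    moreover have "\<forall>d'\<in>F. outer_corner d' ((f(d := s)) d')" using f(2) d(2) by auto
    ultimately show ?thesis by blast
  qed simp
qed

section \<open>Facets of the FFLV polytope\<close>

lemma coord_space_iff: "x \<in> coord_space n \<longleftrightarrow> (\<forall>s. s \<notin> segments n \<longrightarrow> Poly_Mapping.lookup x s = 0)"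
  by (auto simp: coord_space_def in_keys_iff)

lemma subspace_coord_space: "subspace (coord_space n)"
  by (auto simp: subspace_def coord_space_iff lookup_add)

lemma coord_space_point_exists:
  fixes f :: "nat \<times> nat \<Rightarrow> real"
  shows "\<exists>x\<in>coord_space n. \<forall>s\<in>segments n. Poly_Mapping.lookup x s = f s"
proof -
  define g where "g s = (if s \<in> segments n then f s else 0)" for s
  have "finite {s. g s \<noteq> 0}"
    by (rule finite_subset[OF _ finite_segments[of n]]) (auto simp: g_def)
  then have "Poly_Mapping.lookup (Abs_poly_mapping g) = g" by simp
  then show ?thesis
    by (intro bexI[of _ "Abs_poly_mapping g"]) (auto simp: coord_space_iff g_def)
qed

lemma dyck_path_column_exists:
  assumes d: "dyck_path n d" and c: "snd (hd d) \<le> c" "c \<le> snd (last d)"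
  shows "\<exists>r. (r, c) \<in> set d"
proof -
  have st: "successively dyck_step d" and ne: "d \<noteq> []" using d by (auto simp: dyck_path_iff)
  have "\<exists>k. 0 \<le> k \<and> k \<le> length d - 1 \<and> int (snd (d ! k)) = int c"
  proof (rule nat_intermed_int_val)
    show "\<forall>i. 0 \<le> i \<and> i < length d - 1 \<longrightarrow> \<bar>int (snd (d ! Suc i)) - int (snd (d ! i))\<bar> \<le> 1"
    proof (intro allI impI)
      fix i assume "0 \<le> i \<and> i < length d - 1"
      then have "dyck_step (d ! i) (d ! Suc i)" using st by (auto simp: successively_iff_nth)
      then show "\<bar>int (snd (d ! Suc i)) - int (snd (d ! i))\<bar> \<le> 1" by (auto simp: dyck_step_def)
    qed
  qed (use c ne in \<open>auto simp: hd_conv_nth last_conv_nth\<close>)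
  then obtain k where "k < length d" "snd (d ! k) = c"
    using ne by (auto simp: Suc_le_eq le_diff_conv2 dest: le_imp_less_Suc)
  then have "(fst (d ! k), c) \<in> set d" by (metis nth_mem prod.collapse)
  then show ?thesis by blast
qed

lemma dyck_path_column_interval:
  assumes d: "dyck_path n d" and mem: "(r, c) \<in> set d" "(r', c) \<in> set d" and le: "r \<le> x" "x \<le> r'"
  shows "(x, c) \<in> set d"
proof -
  have st: "successively dyck_step d" using d by (auto simp: dyck_path_iff)
  obtain k k' where k: "k < length d" "d ! k = (r, c)" and k': "k' < length d" "d ! k' = (r', c)"
    using mem by (auto simp: in_set_conv_nth)
  have "r + k' = r' + k" using steps_nth_sum[OF st k(1)] steps_nth_sum[OF st k'(1)] k k' by simp
  define m where "m = k + (x - r)"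
  have m: "k \<le> m" "m \<le> k'" "m < length d" using le \<open>r + k' = r' + k\<close> k'(1) by (auto simp: m_def)
  have "snd (d ! m) = c"
    using steps_nth_mono[OF st m(1,3)] steps_nth_mono[OF st m(2) k'(1)] k(2) k'(2) by simp
  moreover have "fst (d ! m) = x"
    using steps_nth_sum[OF st m(3)] steps_nth_sum[OF st k(1)] k(2) le \<open>snd (d ! m) = c\<close>
    by (simp add: m_def)
  ultimately have "d ! m = (x, c)" by (simp add: prod_eq_iff)
  then show ?thesis using m(3) by (metis nth_mem)
qed

text \<open>The point giving weight \<open>a\<^bsub>c-1\<^esub>\<close> to the cell where \<open>d\<close> enters column \<open>c\<close> makes \<open>d\<close> tight, and
  another path is tight only if it visits all these cells in its columns. Adding \<open>\<delta>\<close> along \<open>d\<close> and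
  subtracting \<open>(|d| - 1) \<delta>\<close> at its first cell makes \<open>d\<close> the only violated inequality.\<close>

lemma FFLV_path_irredundant:
  assumes d: "dyck_path n d" and a: "\<forall>i\<in>{1..n - 1}. a i > 0"
  obtains z where "z \<in> coord_space n" "path_bound a d < path_sum z d"
    "\<And>s. s \<in> segments n \<Longrightarrow> 0 \<le> Poly_Mapping.lookup z s"
    "\<And>d'. dyck_path n d' \<Longrightarrow> d' \<noteq> d \<Longrightarrow> path_sum z d' \<le> path_bound a d'"
proof -
  have st: "successively dyck_step d" and ne: "d \<noteq> []" and seg: "set d \<subseteq> segments n"
    using d by (auto simp: dyck_path_iff)
  \<comment> \<open>The cells where \<open>d\<close> enters a column. Rows of cells of
    \<open>d\<close> start at 1, so the truncated subtraction never gives back \<open>s\<close>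
    itself.\<close>
  define Ent where "Ent = {s \<in> set d. (fst s - 1, snd s) \<notin> set d}"
  define N where "N = length d"
  have N: "card (set d) = N" "0 < N"
    using distinct_card[OF steps_distinct[OF st]] ne by (auto simp: N_def)
  \<comment> \<open>With \<open>\<delta> * real N = 1\<close>, both the amount taken from the first
    cell and the gain along any path are at most 1, hence at most each coefficient.\<close>
  define \<delta> where "\<delta> = 1 / real N"
  have \<delta>: "0 < \<delta>" "\<delta> * real N = 1" using N by (auto simp: \<delta>_def)
  define f where "f s = (if s \<in> Ent then real (a (snd s - 1)) else 0) + (if s \<in> set d then \<delta> else 0)
      - (if s = hd d then \<delta> * (real N - 1) else 0)" for s
  obtain z where z: "z \<in> coord_space n" "\<And>s. s \<in> segments n \<Longrightarrow> Poly_Mapping.lookup z s = f s"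
    using coord_space_point_exists[of n f] by blast
  have Ent_inj: "inj_on (\<lambda>s. snd s - 1) Ent"
  proof (rule inj_onI)
    fix s t assume s: "s \<in> Ent" and t: "t \<in> Ent" and eq: "snd s - 1 = snd t - 1"
    have st': "s \<in> segments n" "t \<in> segments n" using s t seg by (auto simp: Ent_def)
    then have eq': "snd s = snd t" using eq by (auto simp: segments_iff)
    have False if "s \<in> Ent" "t \<in> Ent" "snd s = snd t" "fst s < fst t" for s t
    proof -
      have "fst s \<le> fst t - 1" using that(4) by simp
      then have "(fst t - 1, snd t) \<in> set d"
        using dyck_path_column_interval[OF d, of "fst s" "snd s" "fst t" "fst t - 1"] that
        by (cases s; cases t) (auto simp: Ent_def)
      then show False using that(2) by (simp add: Ent_def)
    qed
    then have "fst s = fst t" using s t eq' by (metis nat_neq_iff)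
    then show "s = t" using eq' by (simp add: prod_eq_iff)
  qed
  \<comment> \<open>The indices of the coefficients that \<open>d'\<close> collects at entry cells
    of \<open>d\<close>; the main term reaches the bound of \<open>d'\<close> only if every index in
    its range occurs.\<close>
  define Q where "Q d' = (\<lambda>s. snd s - 1) ` (set d' \<inter> Ent)" for d'
  have path_sum_z: "path_sum z d' = (\<Sum>k\<in>Q d'. real (a k)) + \<delta> * card (set d' \<inter> set d)
      - (if hd d \<in> set d' then \<delta> * (real N - 1) else 0)" if "dyck_path n d'" for d'
  proof -
    have "path_sum z d' = (\<Sum>s\<in>set d'. f s)"
      unfolding path_sum_eq_sum_set[OF that]
      by (rule sum.cong) (use that z(2) in \<open>auto simp: dyck_path_iff\<close>)
    also have "\<dots> = (\<Sum>s\<in>set d' \<inter> Ent. real (a (snd s - 1))) + \<delta> * card (set d' \<inter> set d)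
      - (if hd d \<in> set d' then \<delta> * (real N - 1) else 0)"
      unfolding f_def by (simp add: sum.distrib sum_subtractf flip: sum.inter_restrict)
    also have "(\<Sum>s\<in>set d' \<inter> Ent. real (a (snd s - 1))) = (\<Sum>k\<in>Q d'. real (a k))"
      unfolding Q_def by (subst sum.reindex[OF inj_on_subset[OF Ent_inj]]) auto
    finally show ?thesis .
  qed
  have Q_sub: "Q d' \<subseteq> {fst (hd d')..<snd (last d')}" if d': "dyck_path n d'" for d'
  proof
    fix k assume "k \<in> Q d'"
    then obtain s where s: "s \<in> set d'" "k = snd s - 1" by (auto simp: Q_def)
    show "k \<in> {fst (hd d')..<snd (last d')}"
      using dyck_path_bounds[OF d' s(1)] s(2) d' by (auto simp: dyck_path_iff)
  qed
  have Q_d: "Q d = {fst (hd d)..<snd (last d)}"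
  proof (rule subset_antisym[OF Q_sub[OF d]], rule subsetI)
    fix k assume k: "k \<in> {fst (hd d)..<snd (last d)}"
    have h: "snd (hd d) = fst (hd d) + 1" using d by (simp add: dyck_path_iff)
    have ex: "\<exists>r. (r, k + 1) \<in> set d"
      using dyck_path_column_exists[OF d, of "k + 1"] k h by auto
    define r where "r = (LEAST r. (r, k + 1) \<in> set d)"
    have r: "(r, k + 1) \<in> set d" unfolding r_def using ex by (metis LeastI)
    have "r \<noteq> 0" using r seg by (auto simp: segments_iff)
    then have "(r - 1, k + 1) \<notin> set d" using not_less_Least[of "r - 1" "\<lambda>r. (r, k + 1) \<in> set d"]
      by (auto simp: r_def)
    then have "(r, k + 1) \<in> Ent" using r by (simp add: Ent_def)
    then show "k \<in> Q d" using r unfolding Q_def by (intro image_eqI[of _ _ "(r, k + 1)"]) auto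
  qed
  have hd_Ent: "hd d \<in> Ent"
  proof -
    have "hd d \<in> segments n" using seg ne by auto
    then have "1 \<le> fst (hd d)" by (simp add: segments_iff)
    then show ?thesis
      using dyck_path_bounds(1)[OF d, of "(fst (hd d) - 1, snd (hd d))"] ne by (auto simp: Ent_def)
  qed
  have "path_bound a d < path_sum z d"
  proof -
    have "path_sum z d = path_bound a d + \<delta> * real N - \<delta> * (real N - 1)"
      using path_sum_z[OF d] N ne by (simp add: Q_d path_bound_eq[OF d])
    then show ?thesis using \<delta>(1) by (simp add: algebra_simps)
  qed
  moreover have "0 \<le> Poly_Mapping.lookup z s" if s: "s \<in> segments n" for s
  proof (cases "s = hd d")
    case True
    have "snd s - 1 \<in> {1..n - 1}" using s by (auto simp: segments_iff)
    then have "1 \<le> real (a (snd s - 1))" using bspec[OF a, of "snd s - 1"] by simp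
    moreover have "\<delta> * (real N - 1) \<le> 1" using \<delta> by (simp add: algebra_simps)
    ultimately show ?thesis using z(2)[OF s] True hd_Ent \<delta>(1) ne by (simp add: f_def)
  next
    case False
    then show ?thesis using z(2)[OF s] \<delta>(1) by (simp add: f_def)
  qed
  moreover have "path_sum z d' \<le> path_bound a d'" if d': "dyck_path n d'" "d' \<noteq> d" for d'
  proof (cases "Q d' = {fst (hd d')..<snd (last d')}")
    \<comment> \<open>A missed index costs at least 1, which pays for the whole possible gain
      \<open>\<delta> * real N\<close>.\<close>
    case False
    then obtain k where k: "k \<in> {fst (hd d')..<snd (last d')}" "k \<notin> Q d'"
      using Q_sub[OF d'(1)] by blast
    have "1 \<le> fst (hd d')" "snd (last d') \<le> n"
      using dyck_path_ends_segments[OF d'(1)] by (auto simp: segments_iff)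
    then have "1 \<le> a k" using bspec[OF a, of k] k(1) by (auto simp: Suc_le_eq)
    have "(\<Sum>k\<in>Q d'. real (a k)) \<le> (\<Sum>k\<in>{fst (hd d')..<snd (last d')} - {k}. real (a k))"
      using Q_sub[OF d'(1)] k(2) by (intro sum_mono2) auto
    also have "\<dots> = path_bound a d' - a k"
      unfolding path_bound_eq[OF d'(1)] using k(1) by (simp add: sum_diff1)
    finally have "(\<Sum>k\<in>Q d'. real (a k)) \<le> path_bound a d' - 1" using \<open>1 \<le> a k\<close> by linarith
    moreover have "card (set d' \<inter> set d) \<le> N" using N(1) card_mono[of "set d" "set d' \<inter> set d"] by simp
    then have "\<delta> * real (card (set d' \<inter> set d)) \<le> \<delta> * real N"
      using \<delta>(1) by (intro mult_left_mono) auto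
    moreover have "0 \<le> \<delta> * (real N - 1)" using \<delta>(1) N(2) by simp
    ultimately show ?thesis using path_sum_z[OF d'(1)] \<delta>(2) by (auto split: if_splits)
  next
    \<comment> \<open>Collecting the first coefficient forces \<open>d'\<close> to start at
      \<open>hd d\<close>, where the deduction applies. The gain then stays within the deduction
      unless \<open>d'\<close> contains all of \<open>d\<close>.\<close>
    case True
    have seg': "set d' \<subseteq> segments n" and st': "successively dyck_step d'" and ne': "d' \<noteq> []"
      and h': "snd (hd d') = fst (hd d') + 1"
      using d' by (auto simp: dyck_path_iff)
    have lt: "fst (hd d') < snd (last d')"
      using dyck_path_ends_segments[OF d'(1)] by (simp add: segments_iff)
    then have "fst (hd d') \<in> Q d'" using True by simp
    then obtain s where s: "s \<in> set d'" "s \<in> Ent" "snd s - 1 = fst (hd d')" by (auto simp: Q_def)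
    have "s \<in> segments n" using s(1) seg' by auto
    then have s_eq: "s = hd d'"
      using dyck_path_bounds(1)[OF d'(1) s(1)] s(3) h' by (auto simp: segments_iff prod_eq_iff)
    have "s = hd d"
    proof -
      obtain k where k: "k < length d" "d ! k = s" using s(2) by (auto simp: Ent_def in_set_conv_nth)
      show ?thesis
      proof (cases k)
        case 0
        then show ?thesis using k ne by (simp add: hd_conv_nth)
      next
        case (Suc m)
        then have "dyck_step (d ! m) s" "d ! m \<in> set d" using st k by (auto simp: successively_iff_nth)
        moreover have "s \<noteq> (fst (d ! m) + 1, snd (d ! m))"
          using s(2) \<open>d ! m \<in> set d\<close> by (auto simp: Ent_def)
        moreover have "d ! m \<in> segments n" using \<open>d ! m \<in> set d\<close> seg by blast
        ultimately have False using s_eq h' by (auto simp: dyck_step_def segments_iff)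
        then show ?thesis ..
      qed
    qed
    then have hd_eq: "hd d' = hd d" and hd_in: "hd d \<in> set d'" using s_eq s(1) by auto
    \<comment> \<open>Containment would force the same end, as the last coefficient is collected
      too; paths with the same ends have the same length and would coincide.\<close>
    have "\<not> set d \<subseteq> set d'"
    proof
      assume sub: "set d \<subseteq> set d'"
      then have "last d \<in> set d'" using ne by auto
      then have le: "snd (last d) \<le> snd (last d')" by (rule dyck_path_bounds(4)[OF d'(1)])
      have "snd (last d') - 1 \<in> Q d'" using True lt by auto
      then obtain t where t: "t \<in> set d" "snd t - 1 = snd (last d') - 1" by (auto simp: Q_def Ent_def)
      have "t \<in> segments n" using t(1) seg by blast
      then have "snd (last d') \<le> snd (last d)"
        using dyck_path_bounds(4)[OF d t(1)] t(2) lt by (auto simp: segments_iff)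
      then have "fst (last d) = fst (last d')" using le d d'(1) by (simp add: dyck_path_iff)
      then have len: "length d = length d'"
        using dyck_path_length[OF d] dyck_path_length[OF d'(1)] hd_eq by simp
      have "d' = d"
      proof (rule nth_equalityI)
        fix k assume k: "k < length d'"
        show "d' ! k = d ! k"
          using steps_nth_sum[OF st', of k] steps_nth_sum[OF st, of k] k len hd_eq sub
          by (intro steps_eqI[OF st']) auto
      qed (simp add: len)
      then show False using d'(2) by simp
    qed
    then have "set d' \<inter> set d \<subset> set d" by blast
    then have "card (set d' \<inter> set d) < N" using N(1) psubset_card_mono[of "set d"] by simp
    then have "\<delta> * real (card (set d' \<inter> set d)) \<le> \<delta> * (real N - 1)"
      using \<delta>(1) by (intro mult_left_mono) auto
    then show ?thesis using path_sum_z[OF d'(1)] hd_in True by (simp add: path_bound_eq[OF d'(1)])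
  qed
  ultimately show thesis using that z(1) by blast
qed

section \<open>Tangent cones of the FFLV polytope\<close>

text \<open>Inactive inequalities have slack, so a sufficiently short step in a direction allowed by
  the active ones stays in the polyhedron.\<close>

lemma tangent_cone_polyhedron:
  fixes c :: "'i \<Rightarrow> 'a::real_vector \<Rightarrow> real"
  assumes U: "subspace U" and I: "finite I" and lin: "\<And>i. i \<in> I \<Longrightarrow> linear (c i)"
    and P: "P = {x \<in> U. \<forall>i\<in>I. r i \<le> c i x}" and v: "v \<in> P"
  shows "tangent_cone P v = {u \<in> U. \<forall>i\<in>I. c i v = r i \<longrightarrow> 0 \<le> c i u}"
proof (intro subset_antisym subsetI)
  fix u assume "u \<in> tangent_cone P v"
  then obtain k y where u: "u = k *\<^sub>R (y - v)" "0 \<le> k" "y \<in> P"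
    by (auto simp: tangent_cone_def conic_hull_explicit)
  have "u \<in> U" using u P v U by (auto intro: subspace_diff subspace_scale)
  moreover have "0 \<le> c i u" if "i \<in> I" "c i v = r i" for i
  proof -
    have "c i u = k * (c i y - r i)" using lin[OF that(1)] that(2) u(1) by (simp add: linear_scale linear_diff)
    then show ?thesis using u(2,3) P that(1) by simp
  qed
  ultimately show "u \<in> {u \<in> U. \<forall>i\<in>I. c i v = r i \<longrightarrow> 0 \<le> c i u}" by blast
next
  fix u assume "u \<in> {u \<in> U. \<forall>i\<in>I. c i v = r i \<longrightarrow> 0 \<le> c i u}"
  then have u: "u \<in> U" "\<And>i. i \<in> I \<Longrightarrow> c i v = r i \<Longrightarrow> 0 \<le> c i u" by auto
  have v': "v \<in> U" "\<And>i. i \<in> I \<Longrightarrow> r i \<le> c i v" using v P by auto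
  \<comment> \<open>The step length is \<open>1 / K\<close>: each inactive inequality bounds it
    through its slack, active ones contribute 0 by the convention for division, and the summand 1
    keeps \<open>K\<close> positive.\<close>
  define K where "K = 1 + (\<Sum>i\<in>I. \<bar>c i u\<bar> / (c i v - r i))"
  have K1: "1 \<le> K" unfolding K_def using v' by (simp add: sum_nonneg)
  define y where "y = v + (1 / K) *\<^sub>R u"
  have "r i \<le> c i y" if i: "i \<in> I" for i
  proof -
    have cy: "c i y = c i v + c i u / K"
      using lin[OF i] by (simp add: y_def linear_add linear_scale)
    show ?thesis
    proof (cases "c i v = r i")
      case True
      then show ?thesis using cy u(2)[OF i] K1 by simp
    next
      case False
      then have pos: "0 < c i v - r i" using v'(2)[OF i] by simp
      have "\<bar>c i u\<bar> / (c i v - r i) \<le> (\<Sum>i\<in>I. \<bar>c i u\<bar> / (c i v - r i))"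
        using I i v' by (intro member_le_sum) auto
      then have "\<bar>c i u\<bar> / (c i v - r i) \<le> K" by (simp add: K_def)
      then have "\<bar>c i u\<bar> \<le> K * (c i v - r i)" using pos by (simp add: divide_le_eq)
      then have "\<bar>c i u\<bar> / K \<le> c i v - r i" using K1 by (simp add: divide_le_eq mult.commute)
      moreover have "- (\<bar>c i u\<bar> / K) \<le> c i u / K"
        using K1 divide_right_mono[of "- \<bar>c i u\<bar>" "c i u" K] by simp
      ultimately show ?thesis using cy by linarith
    qed
  qed
  then have "y \<in> P" using P U v'(1) u(1) by (auto simp: y_def intro: subspace_add subspace_scale)
  moreover have "u = K *\<^sub>R (y - v)" using K1 by (simp add: y_def)
  ultimately show "u \<in> tangent_cone P v"
    using K1 unfolding tangent_cone_def conic_hull_explicit by force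
qed

text \<open>Adding a large multiple of the interior direction \<open>y\<close> moves any vector of
  \<open>U\<close> into the cone, so it is a difference of two cone vectors.\<close>

lemma span_cone_interior_point:
  fixes c :: "'i \<Rightarrow> 'a::real_vector \<Rightarrow> real"
  assumes U: "subspace U" and I: "finite I" and lin: "\<And>i. i \<in> I \<Longrightarrow> linear (c i)"
    and y: "y \<in> U" "\<And>i. i \<in> I \<Longrightarrow> 0 < c i y"
  shows "span {u \<in> U. \<forall>i\<in>I. 0 \<le> c i u} = U" (is "span ?T = U")
proof (intro subset_antisym)
  show "span ?T \<subseteq> U" using U by (intro span_minimal) auto
  show "U \<subseteq> span ?T"
  proof
    fix u assume u: "u \<in> U"
    define K where "K = (\<Sum>i\<in>I. \<bar>c i u\<bar> / c i y)"
    have "0 \<le> c i (K *\<^sub>R y + u)" if i: "i \<in> I" for i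
    proof -
      have "\<bar>c i u\<bar> / c i y \<le> K" unfolding K_def
        using I i y(2) by (intro member_le_sum) (auto intro: divide_nonneg_pos)
      then have "\<bar>c i u\<bar> \<le> K * c i y" using y(2)[OF i] by (simp add: divide_le_eq)
      then show ?thesis using lin[OF i] by (simp add: linear_add linear_scale)
    qed
    then have "K *\<^sub>R y + u \<in> ?T" using U u y(1) by (auto intro: subspace_add subspace_scale)
    moreover have "y \<in> ?T" using y by (auto intro: less_imp_le)
    ultimately have "(K *\<^sub>R y + u) - K *\<^sub>R y \<in> span ?T" by (intro span_diff span_scale span_base)
    then show "u \<in> span ?T" by simp
  qed
qed

lemma span_convex_cone_hull: "span (convex_cone hull B) = span B"
proof (rule subset_antisym)
  have "convex_cone hull B \<subseteq> span B"
    by (rule hull_minimal) (auto simp: convex_cone_span span_base)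
  then show "span (convex_cone hull B) \<subseteq> span B" by (rule span_minimal[OF _ subspace_span])
  show "span B \<subseteq> span (convex_cone hull B)" by (intro span_mono hull_subset)
qed

text \<open>The type \<open>point\<close> is infinite-dimensional, so the dimension of the
  coordinate space is counted through its independent unit vectors.\<close>

lemma card_segments_le_spanning:
  assumes "finite B" "coord_space n \<subseteq> span B"
  shows "card (segments n) \<le> card B"
proof -
  let ?e = "\<lambda>s. Poly_Mapping.single s (1::real)"
  have inj: "inj_on ?e (segments n)" by (auto simp: inj_on_def dest: arg_cong[of _ _ Poly_Mapping.keys])
  have "independent (?e ` segments n)"
  proof (rule independent_if_scalars_zero)
    fix f :: "point \<Rightarrow> real" and x assume 0: "(\<Sum>x\<in>?e ` segments n. f x *\<^sub>R x) = 0" and "x \<in> ?e ` segments n"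
    then obtain s where s: "s \<in> segments n" "x = ?e s" by blast
    have "0 = Poly_Mapping.lookup (\<Sum>t\<in>segments n. f (?e t) *\<^sub>R ?e t) s"
      using 0 by (simp add: sum.reindex[OF inj])
    also have "\<dots> = (\<Sum>t\<in>segments n. f (?e t) * (if t = s then 1 else 0))"
      by (simp add: lookup_sum lookup_single when_def)
    also have "\<dots> = f x" using s by (simp add: if_distrib cong: if_cong)
    finally show "f x = 0" ..
  qed simp
  moreover have "?e ` segments n \<subseteq> span B"
    using assms(2) by (auto simp: coord_space_iff lookup_single when_def)
  ultimately have "card (?e ` segments n) \<le> card B"
    using independent_span_bound[OF assms(1)] by blast
  then show ?thesis by (simp add: card_image[OF inj])
qed

section \<open>The FFLV polytope as one system of linear inequalities\<close>

definition constraints :: "nat \<Rightarrow> ((nat \<times> nat) + (nat \<times> nat) list) set" where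
  "constraints n = Inl ` segments n \<union> Inr ` {d. dyck_path n d}"

text \<open>Path functionals are negated so that all constraints become lower bounds.\<close>

definition constraint_fun :: "(nat \<times> nat) + (nat \<times> nat) list \<Rightarrow> point \<Rightarrow> real" where
  "constraint_fun i x = (case i of Inl s \<Rightarrow> Poly_Mapping.lookup x s | Inr d \<Rightarrow> - path_sum x d)"

definition constraint_bound :: "(nat \<Rightarrow> nat) \<Rightarrow> (nat \<times> nat) + (nat \<times> nat) list \<Rightarrow> real" where
  "constraint_bound a i = (case i of Inl s \<Rightarrow> 0 | Inr d \<Rightarrow> - path_bound a d)"

definition active_constraints ::
    "nat \<Rightarrow> (nat \<Rightarrow> nat) \<Rightarrow> point \<Rightarrow> ((nat \<times> nat) + (nat \<times> nat) list) set" where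
  "active_constraints n a v = {i \<in> constraints n. constraint_fun i v = constraint_bound a i}"

lemma constraint_simps [simp]:
  "constraint_fun (Inl s) x = Poly_Mapping.lookup x s"
  "constraint_fun (Inr d) x = - path_sum x d"
  "constraint_bound a (Inl s) = 0"
  "constraint_bound a (Inr d) = - path_bound a d"
  by (simp_all add: constraint_fun_def constraint_bound_def)

lemma finite_constraints [simp]: "finite (constraints n)"
  by (simp add: constraints_def)

lemma finite_active_constraints [simp]: "finite (active_constraints n a v)"
  by (simp add: active_constraints_def)

lemma active_constraints_iff [simp]:
  "Inl s \<in> active_constraints n a v \<longleftrightarrow> s \<in> segments n \<and> Poly_Mapping.lookup v s = 0"
  "Inr d \<in> active_constraints n a v \<longleftrightarrow> dyck_path n d \<and> path_sum v d = path_bound a d"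
  by (auto simp: active_constraints_def constraints_def)

lemma linear_constraint_fun: "linear (constraint_fun i)"
  by (cases i) (auto simp: constraint_fun_def[abs_def] linear_lookup linear_path_sum intro: linear_compose_neg)

lemma FFLV_eq_constraints:
  "FFLV n a = {x \<in> coord_space n. \<forall>i\<in>constraints n. constraint_bound a i \<le> constraint_fun i x}"
  unfolding FFLV_def constraints_def ball_Un by simp

lemma tangent_cone_FFLV:
  assumes "v \<in> FFLV n a"
  shows "tangent_cone (FFLV n a) v =
    {u \<in> coord_space n. \<forall>i\<in>active_constraints n a v. 0 \<le> constraint_fun i u}"
  by (subst tangent_cone_polyhedron[OF subspace_coord_space finite_constraints linear_constraint_fun
        FFLV_eq_constraints assms])
    (auto simp: active_constraints_def)

lemma path_bound_ge_1:
  assumes a: "\<forall>i\<in>{1..n - 1}. a i > 0" and d: "dyck_path n d"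
  shows "1 \<le> path_bound a d"
proof -
  have seg: "(fst (hd d), snd (last d)) \<in> segments n" by (rule dyck_path_ends_segments[OF d])
  then have "fst (hd d) \<in> {1..n - 1}" by (auto simp: segments_iff)
  then have "1 \<le> real (a (fst (hd d)))" using bspec[OF a, of "fst (hd d)"] by (simp add: Suc_le_eq)
  also have "\<dots> \<le> path_bound a d"
    unfolding path_bound_eq[OF d] using seg by (intro member_le_sum) (auto simp: segments_iff)
  finally show ?thesis .
qed

lemma FFLV_interior_point:
  assumes a: "\<forall>i\<in>{1..n - 1}. a i > 0"
  obtains y where "y \<in> coord_space n"
    "\<And>i. i \<in> constraints n \<Longrightarrow> constraint_bound a i < constraint_fun i y"
proof -
  \<comment> \<open>A Dyck path has fewer than \<open>2 * n + 1\<close> cells, so this constant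
    keeps every path sum below 1, the least possible bound.\<close>
  obtain y where y: "y \<in> coord_space n"
    "\<And>s. s \<in> segments n \<Longrightarrow> Poly_Mapping.lookup y s = 1 / (2 * real n + 1)"
    using coord_space_point_exists[of n "\<lambda>_. 1 / (2 * real n + 1)"] by blast
  have "path_sum y d < path_bound a d" if d: "dyck_path n d" for d
  proof -
    have "path_sum y d = real (length d) / (2 * real n + 1)"
    proof -
      have "path_sum y d = (\<Sum>s\<in>set d. 1 / (2 * real n + 1))"
        unfolding path_sum_eq_sum_set[OF d]
        by (rule sum.cong) (use d y(2) in \<open>auto simp: dyck_path_iff\<close>)
      then show ?thesis using d by (simp add: distinct_card steps_distinct dyck_path_iff)
    qed
    also have "\<dots> < 1"
    proof -
      have "last d \<in> segments n" using d by (auto simp: dyck_path_iff)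
      then have "length d < 2 * n + 1" using dyck_path_length[OF d] by (auto simp: segments_iff)
      then show ?thesis by simp
    qed
    also have "1 \<le> path_bound a d" by (rule path_bound_ge_1[OF a d])
    finally show ?thesis .
  qed
  then show thesis using y by (intro that[of y]) (auto simp: constraints_def)
qed

lemma FFLV_constraint_irredundant:
  assumes a: "\<forall>i\<in>{1..n - 1}. a i > 0" and i: "i \<in> constraints n"
  obtains z where "z \<in> coord_space n" "constraint_fun i z < constraint_bound a i"
    "\<And>j. j \<in> constraints n \<Longrightarrow> j \<noteq> i \<Longrightarrow> constraint_bound a j \<le> constraint_fun j z"
proof (cases i)
  case (Inl s)
  \<comment> \<open>Lowering one coordinate from the origin violates only its own sign condition:
    the other coordinates stay 0 and path sums can only drop.\<close>
  let ?z = "Poly_Mapping.single s (- 1 :: real)"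
  have s: "s \<in> segments n" using i Inl by (auto simp: constraints_def)
  have "path_sum ?z d \<le> 0" for d by (induction d) (auto simp: lookup_single when_def)
  moreover have "0 \<le> path_bound a d" for d by (simp add: path_bound_def sum_nonneg)
  ultimately have "path_sum ?z d \<le> path_bound a d" for d by (meson order_trans)
  then show ?thesis using s Inl
    by (intro that[of ?z]) (auto simp: coord_space_iff constraints_def lookup_single when_def split: if_splits)
next
  case (Inr d)
  then have d: "dyck_path n d" using i by (auto simp: constraints_def)
  obtain z where "z \<in> coord_space n" "path_bound a d < path_sum z d"
    "\<And>s. s \<in> segments n \<Longrightarrow> 0 \<le> Poly_Mapping.lookup z s"
    "\<And>d'. dyck_path n d' \<Longrightarrow> d' \<noteq> d \<Longrightarrow> path_sum z d' \<le> path_bound a d'"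
    using FFLV_path_irredundant[OF d a] by blast
  then show ?thesis using Inr
    by (intro that[of z]) (fastforce simp: constraints_def)+
qed

text \<open>An interior point makes the cone full-dimensional, and translating by \<open>v\<close>
  turns the points violating a single inequality of the polytope into witnesses for the cone.
  Duality then applies, and counting generators gives the first claim.\<close>

lemma FFLV_simplicial_dual:
  assumes a: "\<forall>i\<in>{1..n - 1}. a i > 0" and v: "v \<in> FFLV n a"
    and simplicial: "simplicial_cone (tangent_cone (FFLV n a) v)"
  shows "card (segments n) \<le> card (active_constraints n a v)"
    and "i \<in> active_constraints n a v \<Longrightarrow>
      \<exists>w. 0 < constraint_fun i w \<and> (\<forall>j\<in>active_constraints n a v - {i}. constraint_fun j w = 0)"
proof -
  let ?I = "active_constraints n a v"
  obtain B where B: "finite B" "independent B" "tangent_cone (FFLV n a) v = convex_cone hull B"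
    using simplicial by (auto simp: simplicial_cone_def)
  have vU: "v \<in> coord_space n" using v by (simp add: FFLV_def)
  have cone: "convex_cone hull B = {u \<in> coord_space n. \<forall>i\<in>?I. 0 \<le> constraint_fun i u}"
    using B(3) tangent_cone_FFLV[OF v] by simp
  obtain y where y: "y \<in> coord_space n"
      "\<And>i. i \<in> constraints n \<Longrightarrow> constraint_bound a i < constraint_fun i y"
    using FFLV_interior_point[OF a] by blast
  have "0 < constraint_fun i (y - v)" if "i \<in> ?I" for i
    using y(2)[of i] that linear_constraint_fun[of i] by (auto simp: active_constraints_def linear_diff)
  then have "span {u \<in> coord_space n. \<forall>i\<in>?I. 0 \<le> constraint_fun i u} = coord_space n"
    using y(1) vU by (intro span_cone_interior_point[of _ _ _ "y - v"] subspace_coord_space linear_constraint_fun)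
      (auto intro: subspace_diff[OF subspace_coord_space])
  then have span: "span B = coord_space n" using cone by (metis span_convex_cone_hull)
  have irr: "\<exists>z\<in>span B. constraint_fun i z < 0 \<and> (\<forall>j\<in>?I - {i}. 0 \<le> constraint_fun j z)"
    if i: "i \<in> ?I" for i
  proof -
    have "i \<in> constraints n" using i by (simp add: active_constraints_def)
    from FFLV_constraint_irredundant[OF a this] obtain z where z: "z \<in> coord_space n"
      "constraint_fun i z < constraint_bound a i"
      "\<And>j. j \<in> constraints n \<Longrightarrow> j \<noteq> i \<Longrightarrow> constraint_bound a j \<le> constraint_fun j z"
      by blast
    show ?thesis
    proof (intro bexI conjI ballI)
      show "z - v \<in> span B" using z(1) vU span by (simp add: subspace_diff[OF subspace_coord_space])
      show "constraint_fun i (z - v) < 0"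
        using i z(2) linear_constraint_fun[of i] by (auto simp: active_constraints_def linear_diff)
      show "0 \<le> constraint_fun j (z - v)" if "j \<in> ?I - {i}" for j
        using that z(3)[of j] linear_constraint_fun[of j] by (auto simp: active_constraints_def linear_diff)
    qed
  qed
  note dual = simplicial_cone_irredundant_dual[OF B(1,2) finite_active_constraints
      linear_constraint_fun cone[folded span] irr]
  show "card (segments n) \<le> card ?I"
    using card_segments_le_spanning[OF B(1), of n] dual(1) span by simp
  show "\<exists>w. 0 < constraint_fun i w \<and> (\<forall>j\<in>?I - {i}. constraint_fun j w = 0)" if "i \<in> ?I"
    using dual(2)[OF _ that] by blast
qed

section \<open>Simple vertices are laminar\<close>

text \<open>Segments with the same start are always nested, so only distinct starts are compared.
  The non-strict \<open>fst t \<le> snd s\<close> also forbids segments that merely touch.\<close>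

definition laminar :: "(nat \<times> nat) set \<Rightarrow> bool" where
  "laminar E \<longleftrightarrow> (\<forall>s\<in>E. \<forall>t\<in>E. fst s < fst t \<longrightarrow> fst t \<le> snd s \<longrightarrow> snd t \<le> snd s)"

lemma noncrossing_subset: "noncrossing F \<Longrightarrow> G \<subseteq> F \<Longrightarrow> noncrossing G"
  unfolding noncrossing_def by (meson subsetD)

text \<open>The index ranges of \<open>p\<close> and \<open>q\<close> abut, so the bounds add up and
  the linking cell \<open>s\<close> does not enlarge the bound.\<close>

lemma path_bound_concat:
  assumes "dyck_path n p" "dyck_path n q" "dyck_path n (p @ s # q)" "fst (hd q) = snd (last p)"
  shows "path_bound a (p @ s # q) = path_bound a p + path_bound a q"
proof -
  have ne: "p \<noteq> []" "q \<noteq> []" using assms by (auto simp: dyck_path_iff)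
  have "fst (hd p) \<le> snd (last p)" "fst (hd q) \<le> snd (last q)"
    using assms(1,2)[THEN dyck_path_ends_segments] by (auto simp: segments_iff)
  then show ?thesis
    unfolding assms(1-3)[THEN path_bound_eq] using ne assms(4)
    by (simp add: sum.atLeastLessThan_concat)
qed

lemma dyck_path_concat:
  assumes "dyck_path n p" "dyck_path n q" "fst (hd q) = snd (last p)"
  shows "dyck_path n (p @ (fst (last p), snd (last p) + 1) # q)"
proof -
  have "last p \<in> segments n" "hd q \<in> segments n" using assms by (auto simp: dyck_path_iff)
  then show ?thesis using assms
    by (auto simp: dyck_path_iff successively_append_iff successively_Cons dyck_step_def segments_iff
        prod_eq_iff)
qed

locale FFLV_simplicial_vertex =
  fixes n :: nat and a :: "nat \<Rightarrow> nat" and v :: point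
  assumes a: "\<forall>i\<in>{1..n - 1}. a i > 0"
    and v: "v \<in> FFLV n a"
    and simplicial: "simplicial_cone (tangent_cone (FFLV n a) v)"
begin

definition tight :: "(nat \<times> nat) list \<Rightarrow> bool" where
  "tight d \<longleftrightarrow> dyck_path n d \<and> path_sum v d = path_bound a d"

definition supp :: "(nat \<times> nat) set" where
  "supp = {s \<in> segments n. Poly_Mapping.lookup v s \<noteq> 0}"

lemma v_nonneg: "s \<in> segments n \<Longrightarrow> 0 \<le> Poly_Mapping.lookup v s"
  using v by (simp add: FFLV_def)

lemma v_path: "dyck_path n d \<Longrightarrow> path_sum v d \<le> path_bound a d"
  using v by (simp add: FFLV_def)

lemma tight_dual:
  assumes "tight d"
  shows "\<exists>w. path_sum w d < 0 \<and> (\<forall>d'. tight d' \<longrightarrow> d' \<noteq> d \<longrightarrow> path_sum w d' = 0) \<and>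
    (\<forall>s\<in>segments n. Poly_Mapping.lookup v s = 0 \<longrightarrow> Poly_Mapping.lookup w s = 0)"
proof -
  have "Inr d \<in> active_constraints n a v" using assms by (simp add: tight_def)
  from FFLV_simplicial_dual(2)[OF a v simplicial this] obtain w where w: "0 < constraint_fun (Inr d) w"
    "\<forall>j\<in>active_constraints n a v - {Inr d}. constraint_fun j w = 0" by blast
  show ?thesis
  proof (intro exI[of _ w] conjI allI impI ballI)
    show "path_sum w d < 0" using w(1) by simp
    show "path_sum w d' = 0" if "tight d'" "d' \<noteq> d" for d'
      using w(2)[rule_format, of "Inr d'"] that by (simp add: tight_def)
    show "Poly_Mapping.lookup w s = 0" if "s \<in> segments n" "Poly_Mapping.lookup v s = 0" for s
      using w(2)[rule_format, of "Inl s"] that by simp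
  qed
qed

text \<open>The bounds of the exchanged paths have the same total, so these paths are tight too. The
  four path functionals then satisfy a linear relation, which fails on the ray dual to the first
  path if the other three differ from it.\<close>

lemma noncrossing_tight: "noncrossing (Collect tight)"
  unfolding noncrossing_def
proof (intro allI impI)
  fix p q p' q' :: "(nat \<times> nat) list" and s
  assume "p @ s # q \<in> Collect tight \<and> p' @ s # q' \<in> Collect tight"
  then have t: "tight (p @ s # q)" "tight (p' @ s # q')" by auto
  have d: "dyck_path n (p @ s # q)" "dyck_path n (p' @ s # q')" using t by (auto simp: tight_def)
  note d' = dyck_path_swap[OF d] dyck_path_swap[OF d(2,1)]
  have "path_sum v (p @ s # q') = path_bound a (p @ s # q')"
    "path_sum v (p' @ s # q) = path_bound a (p' @ s # q)"
    using dyck_path_swap_bound[OF d, of a] t v_path[OF d'(1)] v_path[OF d'(2)] by (auto simp: tight_def)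
  then have t': "tight (p @ s # q')" "tight (p' @ s # q)" using d' by (auto simp: tight_def)
  show "p = p' \<or> q = q'"
  proof (rule ccontr)
    assume neq: "\<not> (p = p' \<or> q = q')"
    obtain w where w: "path_sum w (p @ s # q) < 0"
      "\<forall>d'. tight d' \<longrightarrow> d' \<noteq> p @ s # q \<longrightarrow> path_sum w d' = 0"
      "\<forall>s\<in>segments n. Poly_Mapping.lookup v s = 0 \<longrightarrow> Poly_Mapping.lookup w s = 0"
      using tight_dual[OF t(1)] by (elim exE conjE)
    \<comment> \<open>A cell occurs once in a path, so different decompositions at \<open>s\<close>
      give different paths.\<close>
    have "distinct (p @ s # q)" "distinct (p' @ s # q')"
      using d steps_distinct unfolding dyck_path_iff by blast+
    then have "s \<notin> set p'" "s \<notin> set q'" by auto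
    then have "p' @ s # q' \<noteq> p @ s # q" using neq append_Cons_eq_iff[of s p' q' p q] by blast
    then have "path_sum w (p' @ s # q') = 0" by (rule w(2)[rule_format, OF t(2)])
    moreover have "path_sum w (p @ s # q') = 0" using neq by (intro w(2)[rule_format, OF t'(1)]) auto
    moreover have "path_sum w (p' @ s # q) = 0" using neq by (intro w(2)[rule_format, OF t'(2)]) auto
    ultimately show False using w(1) by simp
  qed
qed

text \<open>Replacing an inner cell keeps the bound. If \<open>v\<close> vanished at
  \<open>s\<close>, it would vanish at \<open>t\<close> and the new path would be tight; the ray
  dual to the old path vanishes at \<open>s\<close>, at \<open>t\<close> and on the new path, hence
  on the old one.\<close>

lemma tight_flip:
  assumes t: "tight (p @ s # q)" and ne: "p \<noteq> []" "q \<noteq> []" and flip: "dyck_path n (p @ t # q)" "t \<noteq> s"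
  shows "Poly_Mapping.lookup v s \<noteq> 0"
proof
  assume v0: "Poly_Mapping.lookup v s = 0"
  have seg: "s \<in> segments n" "t \<in> segments n" using t flip by (auto simp: tight_def dyck_path_iff)
  have "path_bound a (p @ t # q) = path_bound a (p @ s # q)" using ne by (simp add: path_bound_def)
  then have t0: "Poly_Mapping.lookup v t = 0" and t': "tight (p @ t # q)"
    using v_path[OF flip(1)] t v0 v_nonneg[OF seg(2)] flip(1) by (auto simp: tight_def)
  obtain w where w: "path_sum w (p @ s # q) < 0"
      "\<forall>d'. tight d' \<longrightarrow> d' \<noteq> p @ s # q \<longrightarrow> path_sum w d' = 0"
      "\<forall>s\<in>segments n. Poly_Mapping.lookup v s = 0 \<longrightarrow> Poly_Mapping.lookup w s = 0"
    using tight_dual[OF t] by (elim exE conjE)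
  have "path_sum w (p @ t # q) = 0" using flip(2) by (intro w(2)[rule_format, OF t']) simp
  then show False using w(1) w(3)[rule_format, OF seg(1) v0] w(3)[rule_format, OF seg(2) t0] by simp
qed

lemma inner_corner_in_supp:
  assumes t: "tight d" and c: "inner_corner d s"
  shows "s \<in> supp"
proof -
  obtain p q where d: "d = p @ s # q" "p \<noteq> []" "q \<noteq> []" "s = (fst (last p) + 1, snd (last p))"
    "hd q = (fst s, snd s + 1)" using c by (auto simp: inner_corner_def)
  let ?t = "(fst (last p), snd (last p) + 1)"
  have dp: "dyck_path n (p @ s # q)" using t d(1) by (simp add: tight_def)
  have seg: "last p \<in> segments n" "hd q \<in> segments n" "s \<in> segments n"
    using dp d(2,3) by (auto simp: dyck_path_iff)
  have "?t \<in> segments n" using seg(1,2) d(4,5) by (auto simp: segments_iff)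
  moreover have "dyck_step (last p) ?t" "dyck_step ?t (hd q)" using d(4,5) by (auto simp: dyck_step_def)
  ultimately have "dyck_path n (p @ ?t # q)"
    using dp d(2,3) by (auto simp: dyck_path_iff successively_append_iff successively_Cons)
  then have "Poly_Mapping.lookup v s \<noteq> 0" using t d by (intro tight_flip[of p s q ?t]) auto
  then show ?thesis using seg(3) by (simp add: supp_def)
qed

text \<open>On a one-cell path the value is the bound itself, which is positive. Otherwise the
  corner is flipped inward, unless that hits the diagonal. Then dropping it splits \<open>d\<close>
  into two Dyck paths whose bounds add; if \<open>v\<close> vanished there, both would be tight and
  dependent with \<open>d\<close>.\<close>

lemma outer_corner_in_supp:
  assumes t: "tight d" and c: "outer_corner d s"
  shows "s \<in> supp"
proof -
  obtain p q where d: "d = p @ s # q" "p = [] \<or> s = (fst (last p), snd (last p) + 1)"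
    "q = [] \<or> hd q = (fst s + 1, snd s)" using c by (auto simp: outer_corner_def)
  have dp: "dyck_path n (p @ s # q)" using t d(1) by (simp add: tight_def)
  have seg: "s \<in> segments n" "p \<noteq> [] \<Longrightarrow> last p \<in> segments n" "q \<noteq> [] \<Longrightarrow> hd q \<in> segments n"
    using dp by (auto simp: dyck_path_iff)
  have "Poly_Mapping.lookup v s \<noteq> 0"
  proof (cases "p = [] \<or> q = []")
    case True
    then have "p = [] \<and> q = []"
    proof
      assume p: "p = []"
      then have "snd s = fst s + 1" using dp by (simp add: dyck_path_iff)
      then have "q = []" using d(3) seg(3) by (cases "q = []") (auto simp: segments_iff)
      then show ?thesis using p by simp
    next
      assume q: "q = []"
      then have "snd s = fst s + 1" using dp by (simp add: dyck_path_iff)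
      then have "p = []" using d(2) seg(2) by (cases "p = []") (auto simp: segments_iff)
      then show ?thesis using q by simp
    qed
    then have "Poly_Mapping.lookup v s = path_bound a d" using t d(1) by (simp add: tight_def)
    then show ?thesis using path_bound_ge_1[OF a, of d] t by (auto simp: tight_def)
  next
    case False
    then have ne: "p \<noteq> []" "q \<noteq> []" and s: "s = (fst (last p), snd (last p) + 1)"
      and hq: "hd q = (fst s + 1, snd s)" using d by auto
    show ?thesis
    proof (cases "fst (last p) + 1 < snd (last p)")
      case True
      let ?t = "(fst (last p) + 1, snd (last p))"
      have "?t \<in> segments n" using seg ne True by (auto simp: segments_iff)
      moreover have "dyck_step (last p) ?t" "dyck_step ?t (hd q)" using s hq by (auto simp: dyck_step_def)
      ultimately have "dyck_path n (p @ ?t # q)"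
        using dp ne by (auto simp: dyck_path_iff successively_append_iff successively_Cons)
      moreover have "?t \<noteq> s" using s by (metis fst_conv n_not_Suc_n Suc_eq_plus1)
      ultimately show ?thesis using t d(1) ne by (intro tight_flip[of p s q ?t]) auto
    next
      case False
      then have eq: "snd (last p) = fst (last p) + 1" using seg(2) ne by (auto simp: segments_iff)
      have pq: "dyck_path n p" "dyck_path n q"
        using dp ne eq s hq by (auto simp: dyck_path_iff successively_append_iff successively_Cons)
      have bound: "path_bound a (p @ s # q) = path_bound a p + path_bound a q"
        using path_bound_concat[OF pq dp] hq s eq by simp
      show ?thesis
      proof
        assume v0: "Poly_Mapping.lookup v s = 0"
        have tt: "tight p" "tight q"
          using t d(1) bound v0 v_path[OF pq(1)] v_path[OF pq(2)] pq by (auto simp: tight_def)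
        obtain w where w: "path_sum w d < 0" "\<forall>d'. tight d' \<longrightarrow> d' \<noteq> d \<longrightarrow> path_sum w d' = 0"
          "\<forall>s\<in>segments n. Poly_Mapping.lookup v s = 0 \<longrightarrow> Poly_Mapping.lookup w s = 0"
          using tight_dual[OF t] by (elim exE conjE)
        have "p \<noteq> d" "q \<noteq> d" using d(1) by (auto dest: arg_cong[of _ _ length])
        then show False
          using w(1) w(2)[rule_format, OF tt(1)] w(2)[rule_format, OF tt(2)]
            w(3)[rule_format, OF seg(1) v0] d(1) by simp
      qed
    qed
  qed
  then show ?thesis using seg(1) by (simp add: supp_def)
qed

text \<open>The active constraints are the zero cells and the tight paths, and they are at least as
  many as all cells. So there are at least as many tight paths as support cells, and the injection
  by outer corners is onto.\<close>

lemma supp_outer_corner: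
  assumes "s \<in> supp"
  shows "\<exists>d. tight d \<and> outer_corner d s"
proof -
  have fin: "finite (Collect tight)"
    by (rule finite_subset[OF _ finite_dyck_paths[of n]]) (auto simp: tight_def)
  have supp: "finite supp" "supp \<subseteq> segments n" by (auto simp: supp_def)
  have "active_constraints n a v = (segments n - supp) <+> Collect tight"
    by (auto simp: active_constraints_def constraints_def supp_def tight_def)
  then have "card (active_constraints n a v) = card (segments n - supp) + card (Collect tight)"
    using fin by (simp add: card_Plus)
  then have "card supp \<le> card (Collect tight)"
    using FFLV_simplicial_dual(1)[OF a v simplicial] supp card_mono[OF finite_segments supp(2)]
    by (simp add: card_Diff_subset)
  obtain f where f: "inj_on f (Collect tight)" "\<forall>d\<in>Collect tight. outer_corner d (f d)"
    using noncrossing_corner_injection[OF fin _ noncrossing_tight] by (auto simp: tight_def)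
  have "f ` Collect tight \<subseteq> supp" using f(2) outer_corner_in_supp by blast
  moreover have "card supp \<le> card (f ` Collect tight)"
    using \<open>card supp \<le> card (Collect tight)\<close> by (simp add: card_image[OF f(1)])
  ultimately have "f ` Collect tight = supp" using supp(1) card_seteq by blast
  then obtain d where "tight d" "s = f d" using assms by auto
  then show ?thesis using f(2) by auto
qed

text \<open>An inner corner is a support cell, hence an outer corner of another tight path. The
  exchange property would give both paths the same predecessor or successor there, but a corner of
  the other kind has different ones.\<close>

lemma tight_no_inner_corner:
  assumes "tight d"
  shows "\<not> inner_corner d s"
proof
  assume c: "inner_corner d s"
  obtain d' where d': "tight d'" "outer_corner d' s"
    using supp_outer_corner inner_corner_in_supp[OF assms c] by blast
  obtain p q where d: "d = p @ s # q" "p \<noteq> []" "q \<noteq> []" "s = (fst (last p) + 1, snd (last p))"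
    "hd q = (fst s, snd s + 1)" using c by (auto simp: inner_corner_def)
  obtain p' q' where d'': "d' = p' @ s # q'" "p' = [] \<or> s = (fst (last p'), snd (last p') + 1)"
    "q' = [] \<or> hd q' = (fst s + 1, snd s)" using d'(2) by (auto simp: outer_corner_def)
  have "p = p' \<or> q = q'"
    using noncrossing_tight assms d'(1) d(1) d''(1) unfolding noncrossing_def by blast
  then show False
  proof
    assume "p = p'"
    then have "s = (fst (last p), snd (last p) + 1)" using d''(2) d(2) by blast
    then show False using d(4) by (metis fst_conv n_not_Suc_n Suc_eq_plus1)
  next
    assume "q = q'"
    then have "hd q = (fst s + 1, snd s)" using d''(3) d(3) by blast
    then show False using d(5) by simp
  qed
qed

lemma tight_eq_hook:
  assumes "tight d"
  shows "\<exists>i j. (i, j) \<in> segments n \<and> d = hook i j"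
  using dyck_path_without_inner_corner[OF _ tight_no_inner_corner[OF assms]]
    dyck_path_ends_segments assms unfolding tight_def by blast

lemma tight_hook_iff:
  assumes "(i, j) \<in> segments n"
  shows "tight (hook i j) \<longleftrightarrow> (i, j) \<in> supp"
proof
  have ij: "i < j" using assms by (simp add: segments_iff)
  assume t: "tight (hook i j)"
  \<comment> \<open>The corner injection on this one-path family supplies an outer corner, which on
    a hook can only be \<open>(i, j)\<close>.\<close>
  have "noncrossing {hook i j}"
    using t by (intro noncrossing_subset[OF noncrossing_tight]) simp
  then obtain f where "outer_corner (hook i j) (f (hook i j))"
    using noncrossing_corner_injection[of "{hook i j}" n] dyck_path_hook[OF assms] by auto
  then show "(i, j) \<in> supp" using outer_corner_hook[OF ij] outer_corner_in_supp[OF t] by metis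
next
  assume "(i, j) \<in> supp"
  then obtain d where d: "tight d" "outer_corner d (i, j)" using supp_outer_corner by blast
  obtain k l where kl: "(k, l) \<in> segments n" "d = hook k l" using tight_eq_hook[OF d(1)] by blast
  then have "(i, j) = (k, l)" using outer_corner_hook[of k l] d(2) by (auto simp: segments_iff)
  then show "tight (hook i j)" using d(1) kl(2) by simp
qed

text \<open>Hooks of overlapping segments share the cell \<open>(k, j)\<close>, where exchange would
  force a common start or end. Hooks of touching segments are joined by the cell
  \<open>(j - 1, j + 1)\<close> to a tight path; there \<open>v\<close> would vanish although it is
  an outer corner.\<close>

lemma laminar_supp: "laminar supp"
  unfolding laminar_def
proof (intro ballI impI)
  fix s t assume s: "s \<in> supp" and t: "t \<in> supp" and lt: "fst s < fst t" and le: "fst t \<le> snd s"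
  obtain i j k l where st: "s = (i, j)" "t = (k, l)" by (metis surj_pair)
  have seg: "(i, j) \<in> segments n" "(k, l) \<in> segments n" using s t st by (auto simp: supp_def)
  have ord: "i < j" "k < l" "i < k" "k \<le> j" using seg lt le st by (auto simp: segments_iff)
  have tt: "tight (hook i j)" "tight (hook k l)" using s t st seg tight_hook_iff by auto
  show "snd t \<le> snd s"
  proof (rule ccontr)
    assume "\<not> snd t \<le> snd s"
    then have jl: "j < l" using st by simp
    show False
    proof (cases "k < j")
      case True
      have "(k, j) \<in> set (hook i j)" "(k, j) \<in> set (hook k l)"
        using ord jl True by (auto simp: set_hook)
      then obtain p q p' q' where sp: "hook i j = p @ (k, j) # q" "hook k l = p' @ (k, j) # q'"
        by (metis split_list)
      then have "p = p' \<or> q = q'" using noncrossing_tight tt unfolding noncrossing_def by auto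
      then have "hd (hook i j) = hd (hook k l) \<or> last (hook i j) = last (hook k l)"
        unfolding sp by (auto simp: hd_append)
      then show False using ord jl by (simp add: hd_hook last_hook)
    next
      case False
      then have kj: "k = j" using ord by simp
      have d: "dyck_path n (hook i j)" "dyck_path n (hook k l)" using seg by (auto intro: dyck_path_hook)
      let ?s = "(j - 1, j + 1)"
      let ?d = "hook i j @ ?s # hook k l"
      have link: "fst (hd (hook k l)) = snd (last (hook i j))"
        using ord kj by (simp add: hd_hook last_hook)
      have dd: "dyck_path n ?d" using dyck_path_concat[OF d link] ord by (simp add: last_hook)
      have s_seg: "?s \<in> segments n" using dd by (auto simp: dyck_path_iff)
      have "path_sum v ?d = path_bound a ?d + Poly_Mapping.lookup v ?s"
        using path_bound_concat[OF d dd link] tt by (simp add: tight_def)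
      then have v0: "Poly_Mapping.lookup v ?s = 0" and td: "tight ?d"
        using v_path[OF dd] v_nonneg[OF s_seg] dd by (auto simp: tight_def)
      have "outer_corner ?d ?s" unfolding outer_corner_def
        using ord kj by (intro exI[of _ "hook i j"] exI[of _ "hook k l"] conjI disjI2)
          (auto simp: last_hook hd_hook)
      then have "?s \<in> supp" by (rule outer_corner_in_supp[OF td])
      then show False using v0 by (simp add: supp_def)
    qed
  qed
qed

lemma v_eq_segment_point: "v = segment_point n a supp"
proof -
  have "is_segment_point n a supp v"
    unfolding is_segment_point_def
  proof (intro conjI ballI)
    show "v \<in> coord_space n" using v by (simp add: FFLV_def)
    fix s assume s: "s \<in> segments n"
    obtain i j where ij: "s = (i, j)" by fastforce
    have "path_sum v (hook i j) = (\<Sum>k = i..<j. real (a k))" if "(i, j) \<in> supp"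
      using tight_hook_iff[of i j] path_bound_hook[of i j n a] that s ij by (simp add: tight_def)
    then show "case s of (i, j) \<Rightarrow> ((i, j) \<notin> supp \<longrightarrow> Poly_Mapping.lookup v (i, j) = 0) \<and>
        ((i, j) \<in> supp \<longrightarrow> path_sum v (hook i j) = (\<Sum>k = i..<j. real (a k)))"
      using s ij by (simp add: supp_def)
  qed
  then show ?thesis using segment_point_spec is_segment_point_ex1 by blast
qed

end

section \<open>Laminar sets give simple vertices\<close>

locale laminar_segment_point =
  fixes n :: nat and a :: "nat \<Rightarrow> nat" and E :: "(nat \<times> nat) set" and v :: point
  assumes a: "\<forall>i\<in>{1..n - 1}. a i > 0"
    and E: "E \<subseteq> segments n" "laminar E"
    and v_def: "v = segment_point n a E"
begin

abbreviation wt :: "nat \<Rightarrow> nat \<Rightarrow> real" where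
  "wt i j \<equiv> (\<Sum>k = i..<j. real (a k))"

abbreviation val :: "nat \<times> nat \<Rightarrow> real" where
  "val s \<equiv> Poly_Mapping.lookup v s"

text \<open>Abstracts the cells of \<open>E\<close> on a Dyck path; unlike a path, such a set can be
  cut into pieces freely.\<close>

definition chain_in :: "nat \<Rightarrow> nat \<Rightarrow> (nat \<times> nat) set \<Rightarrow> bool" where
  "chain_in i j C \<longleftrightarrow> C \<subseteq> E \<and> (\<forall>s\<in>C. i \<le> fst s \<and> snd s \<le> j) \<and>
     (\<forall>s\<in>C. \<forall>t\<in>C. fst s \<le> fst t \<and> snd s \<le> snd t \<or> fst t \<le> fst s \<and> snd t \<le> snd s)"

lemma v_space: "v \<in> coord_space n"
  using segment_point_spec[of n a E] by (simp add: v_def is_segment_point_def)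

lemma val_outside: "s \<notin> E \<Longrightarrow> val s = 0"
  using segment_point_spec[of n a E] v_space
  by (cases s) (auto simp: v_def is_segment_point_def coord_space_iff)

lemma path_sum_hook_E: "(i, j) \<in> E \<Longrightarrow> path_sum v (hook i j) = wt i j"
  using segment_point_spec[of n a E] E(1) by (auto simp: v_def is_segment_point_def)

lemma sum_hook_E:
  assumes "(i, j) \<in> E"
  shows "(\<Sum>s\<in>set (hook i j). val s) = wt i j"
  using path_sum_hook_E[OF assms] path_sum_eq_sum_set[OF dyck_path_hook] E(1) assms by (metis subsetD)

lemma sum_Int_E: "finite S \<Longrightarrow> (\<Sum>s\<in>S. val s) = (\<Sum>s\<in>S \<inter> E. val s)"
  by (rule sum.mono_neutral_right) (auto simp: val_outside)

lemma wt_pos: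
  assumes "1 \<le> i" "i < j" "j \<le> n"
  shows "0 < wt i j"
  using assms a by (intro sum_pos) auto

lemma wt_split: "i \<le> j \<Longrightarrow> j \<le> k \<Longrightarrow> wt i k = wt i j + wt j k"
  by (simp add: sum.atLeastLessThan_concat)

text \<open>Comparability with \<open>(p, q)\<close> puts every cell of the chain in row
  \<open>p\<close> or column \<open>q\<close>, thus on a hook of sum \<open>wt p q\<close>.
  Nonnegativity is assumed only inside \<open>[p, q]\<close>, so that the lemma can serve while
  positivity is still being proved.\<close>

lemma chain_with_top:
  assumes C: "chain_in p q C" "(p, q) \<in> C"
    and nonneg: "\<And>s. s \<in> E \<Longrightarrow> p \<le> fst s \<Longrightarrow> snd s \<le> q \<Longrightarrow> 0 \<le> val s"
  shows "(\<Sum>s\<in>C. val s) \<le> wt p q"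
proof -
  have pq: "(p, q) \<in> E" "p < q" using C E(1) by (auto simp: chain_in_def segments_iff)
  have "C \<subseteq> set (hook p q)"
  proof
    fix s assume s: "s \<in> C"
    then have "fst s < snd s" "p \<le> fst s" "snd s \<le> q"
      using C(1) E(1) by (auto simp: chain_in_def segments_iff)
    moreover have "fst s \<le> p \<and> snd s \<le> q \<or> p \<le> fst s \<and> q \<le> snd s"
      using C s unfolding chain_in_def by fastforce
    ultimately show "s \<in> set (hook p q)" using pq(2) by (auto simp: set_hook)
  qed
  moreover have "0 \<le> val s" if "s \<in> set (hook p q)" for s
    using nonneg[of s] val_outside[of s] that pq(2) by (cases "s \<in> E") (auto simp: set_hook)
  ultimately have "(\<Sum>s\<in>C. val s) \<le> (\<Sum>s\<in>set (hook p q). val s)"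
    by (intro sum_mono2) auto
  then show ?thesis using sum_hook_E[OF pq(1)] by simp
qed

text \<open>The remaining cells of \<open>E\<close> on the hook form a chain without
  \<open>(i, j)\<close>; its sum falls short of \<open>wt i j\<close>, and the value at
  \<open>(i, j)\<close> fills the gap.\<close>

lemma val_pos_from_chains:
  assumes E': "(i, j) \<in> E" and strict: "\<And>C. chain_in i j C \<Longrightarrow> (i, j) \<notin> C \<Longrightarrow> (\<Sum>s\<in>C. val s) < wt i j"
  shows "0 < val (i, j)"
proof -
  have ij: "i < j" "(i, j) \<in> segments n" using E' E(1) by (auto simp: segments_iff)
  let ?C = "set (hook i j) \<inter> E"
  have "chain_in i j (?C - {(i, j)})"
    unfolding chain_in_def
  proof (intro conjI ballI)
    fix s t assume "s \<in> ?C - {(i, j)}" "t \<in> ?C - {(i, j)}"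
    then show "fst s \<le> fst t \<and> snd s \<le> snd t \<or> fst t \<le> fst s \<and> snd t \<le> snd s"
      using dyck_path_hook[OF ij(2)] by (intro steps_comparable[of "hook i j"]) (auto simp: dyck_path_iff)
  qed (use ij(1) in \<open>auto simp: set_hook\<close>)
  from strict[OF this] have "(\<Sum>s\<in>?C - {(i, j)}. val s) < wt i j" by simp
  moreover have "wt i j = (\<Sum>s\<in>?C. val s)" using sum_hook_E[OF E'] by (simp flip: sum_Int_E)
  moreover have "(\<Sum>s\<in>?C. val s) = val (i, j) + (\<Sum>s\<in>?C - {(i, j)}. val s)"
  proof (rule sum.remove)
    show "(i, j) \<in> ?C" using E' ij(1) by (simp add: set_hook)
  qed simp
  ultimately show ?thesis by simp
qed

text \<open>If \<open>(p, q)\<close> is the last cell of the chain in its first row, laminarity forces the cells in columns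
  beyond \<open>q\<close> to start beyond \<open>q\<close>, while the other cells lie on the hook of \<open>(p, q)\<close>.\<close>

lemma chain_sum_less:
  assumes "1 \<le> i" "i < j" "j \<le> n" "chain_in i j C" "(i, j) \<notin> C"
  shows "(\<Sum>s\<in>C. val s) < wt i j"
  using assms
proof (induction "j - i" arbitrary: i j C rule: less_induct)
  case less
  have C: "C \<subseteq> E" "\<And>s. s \<in> C \<Longrightarrow> i \<le> fst s \<and> snd s \<le> j"
    "\<And>s t. s \<in> C \<Longrightarrow> t \<in> C \<Longrightarrow> fst s \<le> fst t \<and> snd s \<le> snd t \<or> fst t \<le> fst s \<and> snd t \<le> snd s"
    using less.prems(4) unfolding chain_in_def by (blast, blast, elim conjE, blast)
  have Cseg: "1 \<le> fst s \<and> fst s < snd s \<and> snd s \<le> n" if "s \<in> E" for s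
    using E(1) that by (auto simp: segments_iff)
  have fin: "finite C" by (rule finite_subset[OF subset_trans[OF C(1) E(1)] finite_segments])
  \<comment> \<open>The induction hypothesis for shorter segments already yields positivity
    there.\<close>
  have pos: "0 \<le> val s" if "s \<in> E" "snd s - fst s < j - i" for s
  proof -
    have "0 < val (fst s, snd s)"
      using Cseg[OF that(1)] that by (intro val_pos_from_chains less.hyps) auto
    then show ?thesis by simp
  qed
  show ?case
  proof (cases "C = {}")
    case True
    then show ?thesis using wt_pos less.prems by simp
  next
    case False
    define p where "p = Min (fst ` C)"
    have p_min: "p \<le> fst s" if "s \<in> C" for s unfolding p_def using fin that by simp
    have "p \<in> fst ` C" unfolding p_def using fin False by simp
    then have ne: "{s \<in> C. fst s = p} \<noteq> {}" by auto
    define q where "q = Max (snd ` {s \<in> C. fst s = p})"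
    have q_max: "snd s \<le> q" if "s \<in> C" "fst s = p" for s unfolding q_def using fin that by simp
    have "q \<in> snd ` {s \<in> C. fst s = p}" unfolding q_def using fin ne by (intro Max_in) auto
    then have pq: "(p, q) \<in> C" by auto
    have pqE: "(p, q) \<in> E" using pq C(1) by blast
    have bounds: "i \<le> p" "p < q" "q \<le> j" using C(2)[OF pq] Cseg[OF pqE] by auto
    have "p \<noteq> i \<or> q \<noteq> j" using pq less.prems(5) by auto
    then have smaller: "q - p < j - i" using bounds by linarith
    define C1 where "C1 = {s \<in> C. snd s \<le> q}"
    define C2 where "C2 = {s \<in> C. q < snd s}"
    have "chain_in p q C1" using C p_min unfolding chain_in_def C1_def by blast
    then have sum1: "(\<Sum>s\<in>C1. val s) \<le> wt p q"
      using pq smaller by (intro chain_with_top pos) (auto simp: C1_def)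
    have start2: "q + 1 \<le> fst s" if "s \<in> C2" for s
    proof (rule ccontr)
      assume "\<not> q + 1 \<le> fst s"
      moreover have s: "s \<in> C" "q < snd s" using that by (auto simp: C2_def)
      moreover have "fst s \<noteq> p" using q_max[of s] s by linarith
      then have "p < fst s" using p_min[OF s(1)] by simp
      moreover have "s \<in> E" using s(1) C(1) by blast
      ultimately show False using E(2) pqE unfolding laminar_def by force
    qed
    have C2: "s \<in> C" "s \<in> E" if "s \<in> C2" for s using that C(1) by (auto simp: C2_def)
    have chain2: "chain_in (q + 1) j C2"
      unfolding chain_in_def
    proof (intro conjI ballI)
      fix s t assume "s \<in> C2" "t \<in> C2"
      then show "fst s \<le> fst t \<and> snd s \<le> snd t \<or> fst t \<le> fst s \<and> snd t \<le> snd s"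
        using C2(1) by (intro C(3))
    qed (use C2 C(2) start2 in auto)
    have sum2: "(\<Sum>s\<in>C2. val s) \<le> wt (q + 1) j"
    proof (cases "C2 = {}")
      case True
      then show ?thesis by (simp add: sum_nonneg)
    next
      case False
      then obtain t where t: "t \<in> C2" by blast
      have "q + 1 < j" using start2[OF t] Cseg[OF C2(2)[OF t]] C(2)[OF C2(1)[OF t]] by linarith
      show ?thesis
      proof (cases "(q + 1, j) \<in> C2")
        case True
        then show ?thesis using chain2 bounds \<open>q + 1 < j\<close> by (intro chain_with_top pos) auto
      next
        case False
        have "j - (q + 1) < j - i" using bounds \<open>q + 1 < j\<close> by linarith
        then show ?thesis using False
          less.hyps[of j "q + 1" C2] chain2 bounds \<open>q + 1 < j\<close> less.prems(3) by simp
      qed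
    qed
    have "C = C1 \<union> C2" "C1 \<inter> C2 = {}" by (auto simp: C1_def C2_def)
    then have "(\<Sum>s\<in>C. val s) = (\<Sum>s\<in>C1. val s) + (\<Sum>s\<in>C2. val s)"
      using fin by (simp add: sum.union_disjoint)
    also have "\<dots> \<le> wt p q + wt (q + 1) j" using sum1 sum2 by simp
    \<comment> \<open>The strict gain is the coefficient at \<open>q\<close> when
      \<open>q < j\<close>; when \<open>q = j\<close>, the missing cell \<open>(i, j)\<close> forces
      \<open>i < p\<close> and the gain is \<open>wt i p\<close>.\<close>
    also have "\<dots> < wt i j"
    proof (cases "q = j")
      case True
      then have "i < p" using bounds pq less.prems(5) by (cases "p = i") auto
      then have "0 < wt i p" using less.prems Cseg[OF pqE] by (intro wt_pos) auto
      then show ?thesis using True wt_split[of i p j] bounds by simp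
    next
      case False
      then have "wt i j = wt i p + wt p q + wt q (q + 1) + wt (q + 1) j"
        using wt_split[of i p j] wt_split[of p q j] wt_split[of q "q + 1" j] bounds by simp
      moreover have "0 < wt q (q + 1)" using False bounds less.prems by (intro wt_pos) auto
      moreover have "0 \<le> wt i p" by (simp add: sum_nonneg)
      ultimately show ?thesis by linarith
    qed
    finally show ?thesis .
  qed
qed

lemma val_pos:
  assumes "s \<in> E"
  shows "0 < val s"
proof -
  have "s \<in> segments n" using assms E(1) by blast
  then have "0 < val (fst s, snd s)"
    using assms by (intro val_pos_from_chains chain_sum_less) (auto simp: segments_iff)
  then show ?thesis by simp
qed

lemma val_nonneg: "0 \<le> val s"
  using val_pos[of s] val_outside[of s] by (cases "s \<in> E") auto

text \<open>A path through its extreme cell is a hook. If that cell is off the path or outside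
  \<open>E\<close>, the cells of \<open>E\<close> on the path form a chain avoiding it, and the
  strict chain bound applies.\<close>

lemma path_sum_less_or_hook:
  assumes d: "dyck_path n d"
  shows "path_sum v d < path_bound a d \<or> (\<exists>(i, j)\<in>E. d = hook i j)"
proof (cases "(fst (hd d), snd (last d)) \<in> set d \<inter> E")
  case True
  then have "d = hook (fst (hd d)) (snd (last d))" using dyck_path_eq_hook[OF d] by blast
  then show ?thesis using True by blast
next
  case False
  have seg: "(fst (hd d), snd (last d)) \<in> segments n" by (rule dyck_path_ends_segments[OF d])
  have "chain_in (fst (hd d)) (snd (last d)) (set d \<inter> E)"
    unfolding chain_in_def
  proof (intro conjI ballI)
    fix s t assume "s \<in> set d \<inter> E" "t \<in> set d \<inter> E"
    then show "fst s \<le> fst t \<and> snd s \<le> snd t \<or> fst t \<le> fst s \<and> snd t \<le> snd s"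
      using d by (intro steps_comparable[of d]) (auto simp: dyck_path_iff)
  qed (use dyck_path_bounds[OF d] in auto)
  then have "(\<Sum>s\<in>set d \<inter> E. val s) < wt (fst (hd d)) (snd (last d))"
    using seg False by (intro chain_sum_less) (auto simp: segments_iff)
  then show ?thesis
    using path_sum_eq_sum_set[OF d, of v] path_bound_eq[OF d, of a] sum_Int_E[of "set d"] by simp
qed

lemma path_sum_hook_tight: "(i, j) \<in> E \<Longrightarrow> path_sum v (hook i j) = path_bound a (hook i j)"
  using path_sum_hook_E path_bound_hook E(1) by (metis subsetD)

lemma v_FFLV: "v \<in> FFLV n a"
proof -
  have "path_sum v d \<le> path_bound a d" if "dyck_path n d" for d
    using path_sum_less_or_hook[OF that] path_sum_hook_tight by fastforce
  then show ?thesis using v_space val_nonneg by (simp add: FFLV_def)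
qed

end

text \<open>The functionals are coordinates on \<open>U\<close> with respect to the vectors
  \<open>b s\<close>: the cone is the nonnegative orthant and the lattice consists of the points
  with integer coordinates.\<close>

lemma dual_basis_cone:
  fixes \<phi> :: "'s \<Rightarrow> 'a::real_vector \<Rightarrow> real"
  assumes U: "subspace U" and S: "finite S" and lin: "\<And>s. s \<in> S \<Longrightarrow> linear (\<phi> s)"
    and b: "\<And>s. s \<in> S \<Longrightarrow> b s \<in> U"
      "\<And>s t. s \<in> S \<Longrightarrow> t \<in> S \<Longrightarrow> \<phi> t (b s) = (if s = t then 1 else 0)"
    and zero: "\<And>u. u \<in> U \<Longrightarrow> \<forall>s\<in>S. \<phi> s u = 0 \<Longrightarrow> u = 0"
  defines "C \<equiv> {u \<in> U. \<forall>s\<in>S. 0 \<le> \<phi> s u}"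
  shows "simplicial_cone C" "unimodular_cone {u \<in> U. \<forall>s\<in>S. \<phi> s u \<in> \<int>} C"
proof -
  let ?B = "b ` S"
  have phi_sum: "\<phi> t (\<Sum>s\<in>S. k s *\<^sub>R b s) = k t" if "t \<in> S" for k t
  proof -
    have "\<phi> t (\<Sum>s\<in>S. k s *\<^sub>R b s) = (\<Sum>s\<in>S. k s * (if s = t then 1 else 0))"
      using lin[OF that] b(2) that by (simp add: linear_sum linear_scale)
    also have "\<dots> = k t" using S that by (simp add: if_distrib cong: if_cong)
    finally show ?thesis .
  qed
  have sum_U: "(\<Sum>s\<in>S. k s *\<^sub>R b s) \<in> U" for k
    using U b(1) by (intro subspace_sum subspace_scale) auto
  have expand: "u = (\<Sum>s\<in>S. \<phi> s u *\<^sub>R b s)" if "u \<in> U" for u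
  proof -
    have "u - (\<Sum>s\<in>S. \<phi> s u *\<^sub>R b s) = 0"
    proof (rule zero)
      show "\<forall>t\<in>S. \<phi> t (u - (\<Sum>s\<in>S. \<phi> s u *\<^sub>R b s)) = 0"
        using lin phi_sum by (simp add: linear_diff)
    qed (use U that sum_U in \<open>auto intro: subspace_diff\<close>)
    then show ?thesis by simp
  qed
  have inj: "inj_on b S"
    by (rule inj_onI) (metis b(2) zero_neq_one)
  have reindex: "(\<Sum>x\<in>?B. k x *\<^sub>R x) = (\<Sum>s\<in>S. k (b s) *\<^sub>R b s)" for k
    by (simp add: sum.reindex[OF inj])
  have fin: "finite ?B" using S by simp
  have indep: "independent ?B"
  proof (rule independent_if_scalars_zero[OF fin])
    fix k x assume 0: "(\<Sum>x\<in>?B. k x *\<^sub>R x) = 0" and "x \<in> ?B"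
    then obtain t where t: "t \<in> S" "x = b t" by blast
    have "k (b t) = \<phi> t (\<Sum>x\<in>?B. k x *\<^sub>R x)" using phi_sum[OF t(1)] by (simp add: reindex)
    then show "k x = 0" using 0 t lin by (simp add: linear_0)
  qed
  have cone: "C = convex_cone hull ?B"
  proof (intro subset_antisym subsetI)
    fix u assume "u \<in> C"
    then have u: "u \<in> U" "\<forall>s\<in>S. 0 \<le> \<phi> s u" by (auto simp: C_def)
    have "u = (\<Sum>x\<in>?B. \<phi> (the_inv_into S b x) u *\<^sub>R x)"
      using expand[OF u(1)] by (simp add: reindex the_inv_into_f_f[OF inj])
    moreover have "\<forall>x\<in>?B. 0 \<le> \<phi> (the_inv_into S b x) u"
      using u(2) by (simp add: the_inv_into_f_f[OF inj])
    ultimately show "u \<in> convex_cone hull ?B" unfolding convex_cone_hull_finite[OF fin]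
      by (intro CollectI exI[of _ "\<lambda>x. \<phi> (the_inv_into S b x) u"] conjI)
  next
    fix u assume "u \<in> convex_cone hull ?B"
    then obtain k where "u = (\<Sum>x\<in>?B. k x *\<^sub>R x)" "\<forall>x\<in>?B. 0 \<le> k x"
      unfolding convex_cone_hull_finite[OF fin] by blast
    then show "u \<in> C" using phi_sum sum_U by (simp add: C_def reindex)
  qed
  show "simplicial_cone C" unfolding simplicial_cone_def using fin indep cone by blast
  have span: "span C = U"
  proof (rule subset_antisym)
    show "span C \<subseteq> U" using U by (intro span_minimal) (auto simp: C_def)
    show "U \<subseteq> span C"
    proof
      fix u assume "u \<in> U"
      then have "(\<Sum>s\<in>S. \<phi> s u *\<^sub>R b s) = u" using expand by simp
      moreover have "(\<Sum>s\<in>S. \<phi> s u *\<^sub>R b s) \<in> span C"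
        using b by (intro span_sum span_scale span_base) (auto simp: C_def)
      ultimately show "u \<in> span C" by simp
    qed
  qed
  have "{u \<in> U. \<forall>s\<in>S. \<phi> s u \<in> \<int>} \<inter> span C = {(\<Sum>x\<in>?B. of_int (k x) *\<^sub>R x) |k :: 'a \<Rightarrow> int. True}"
  proof (intro subset_antisym subsetI)
    fix u assume "u \<in> {u \<in> U. \<forall>s\<in>S. \<phi> s u \<in> \<int>} \<inter> span C"
    then have u: "u \<in> U" "\<forall>s\<in>S. \<phi> s u \<in> \<int>" by auto
    \<comment> \<open>The coordinates are integers, so the floor is exact; the inverse of
      \<open>b\<close> is needed because unimodularity sums over the set of generators.\<close>
    define k where "k x = \<lfloor>\<phi> (the_inv_into S b x) u\<rfloor>" for x
    have "of_int (k (b s)) = \<phi> s u" if "s \<in> S" for s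
      using u(2) that by (auto simp: k_def the_inv_into_f_f[OF inj] elim: Ints_cases)
    then have "u = (\<Sum>x\<in>?B. of_int (k x) *\<^sub>R x)" using expand[OF u(1)] by (simp add: reindex)
    then show "u \<in> {(\<Sum>x\<in>?B. of_int (k x) *\<^sub>R x) |k :: 'a \<Rightarrow> int. True}" by blast
  next
    fix u assume "u \<in> {(\<Sum>x\<in>?B. of_int (k x) *\<^sub>R x) |k :: 'a \<Rightarrow> int. True}"
    then obtain k :: "'a \<Rightarrow> int" where "u = (\<Sum>x\<in>?B. of_int (k x) *\<^sub>R x)" by blast
    then show "u \<in> {u \<in> U. \<forall>s\<in>S. \<phi> s u \<in> \<int>} \<inter> span C"
      using phi_sum sum_U span by (simp add: reindex)
  qed
  then show "unimodular_cone {u \<in> U. \<forall>s\<in>S. \<phi> s u \<in> \<int>} C"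
    unfolding unimodular_cone_def using fin indep cone by blast
qed

text \<open>For laminar \<open>E\<close>, these are the active constraint functionals at
  \<open>x(E)\<close>, one per cell and with the same sign as in
  \<open>constraint_fun\<close>.\<close>

definition hook_coeff :: "(nat \<times> nat) set \<Rightarrow> nat \<times> nat \<Rightarrow> point \<Rightarrow> real" where
  "hook_coeff E s u =
     (if s \<in> E then - path_sum u (hook (fst s) (snd s)) else Poly_Mapping.lookup u s)"

lemma linear_hook_coeff: "linear (hook_coeff E s)"
  by (rule linearI) (auto simp: hook_coeff_def lookup_add)

text \<open>Forward substitution for the triangular system with right-hand side \<open>f\<close>:
  the other cells of a hook belong to shorter segments.\<close>

function hook_solution :: "(nat \<times> nat) set \<Rightarrow> (nat \<times> nat \<Rightarrow> real) \<Rightarrow> nat \<Rightarrow> nat \<Rightarrow> real" where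
  "hook_solution E f i j =
     (if (i, j) \<in> E
      then - f (i, j) - (\<Sum>k = i + 1..<j. hook_solution E f i k)
             - (\<Sum>k = i + 1..<j. hook_solution E f k j)
      else f (i, j))"
  by auto
termination
  by (relation "Wellfounded.measure (\<lambda>(E, f, i, j). j - i)") auto

declare hook_solution.simps [simp del]

lemma hook_coeff_surj: "\<exists>u\<in>coord_space n. \<forall>s\<in>segments n. hook_coeff E s u = f s"
proof -
  obtain u where u: "u \<in> coord_space n"
    "\<forall>s\<in>segments n. Poly_Mapping.lookup u s = hook_solution E f (fst s) (snd s)"
    using coord_space_point_exists[of n "\<lambda>s. hook_solution E f (fst s) (snd s)"] by blast
  have "hook_coeff E s u = f s" if s: "s \<in> segments n" for s
  proof -
    obtain i j where ij: "s = (i, j)" by fastforce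
    have b: "1 \<le> i" "i < j" "j \<le> n" using s ij by (auto simp: segments_iff)
    have 1: "(\<Sum>k = i + 1..<j. Poly_Mapping.lookup u (i, k)) = (\<Sum>k = i + 1..<j. hook_solution E f i k)"
      by (rule sum.cong) (use b u(2) in \<open>auto simp: segments_iff\<close>)
    have 2: "(\<Sum>k = i + 1..<j. Poly_Mapping.lookup u (k, j)) = (\<Sum>k = i + 1..<j. hook_solution E f k j)"
      by (rule sum.cong) (use b u(2) in \<open>auto simp: segments_iff\<close>)
    have 3: "Poly_Mapping.lookup u (i, j) = hook_solution E f i j" using u(2) s ij by simp
    show ?thesis
      unfolding ij hook_coeff_def fst_conv snd_conv path_sum_hook[OF b(2)] 1 2 3
      by (subst (1 2) hook_solution.simps) auto
  qed
  then show ?thesis using u(1) by blast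
qed

text \<open>The diagonal entries are 1 or -1, so substitution needs no division and stays in any
  additive subgroup \<open>G\<close>. Taking \<open>{0}\<close> gives uniqueness and taking the
  integers gives unimodularity.\<close>

lemma lookup_from_hook_coeff:
  assumes G: "0 \<in> G" "\<And>x y. x \<in> G \<Longrightarrow> y \<in> G \<Longrightarrow> x - y \<in> G"
    and u: "\<forall>s\<in>segments n. hook_coeff E s u \<in> G"
  shows "(i, j) \<in> segments n \<Longrightarrow> Poly_Mapping.lookup u (i, j) \<in> G"
proof (induction "j - i" arbitrary: i j rule: less_induct)
  case less
  have add: "x + y \<in> G" if "x \<in> G" "y \<in> G" for x y
    using G(2)[OF that(1) G(2)[OF G(1) that(2)]] by simp
  have sum: "(\<Sum>k\<in>A. h k) \<in> G" if "finite A" "\<And>k. k \<in> A \<Longrightarrow> h k \<in> G" for A :: "nat set" and h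
    using that by (induction A rule: finite_induct) (auto simp: G(1) add)
  have b: "1 \<le> i" "i < j" "j \<le> n" using less.prems by (auto simp: segments_iff)
  have 1: "(\<Sum>k = i + 1..<j. Poly_Mapping.lookup u (i, k)) \<in> G"
    by (rule sum, simp, rule less.hyps) (use b in \<open>auto simp: segments_iff\<close>)
  have 2: "(\<Sum>k = i + 1..<j. Poly_Mapping.lookup u (k, j)) \<in> G"
    by (rule sum, simp, rule less.hyps) (use b in \<open>auto simp: segments_iff\<close>)
  have 0: "hook_coeff E (i, j) u \<in> G" using u less.prems by blast
  show ?case
  proof (cases "(i, j) \<in> E")
    case True
    then have "Poly_Mapping.lookup u (i, j) = 0 - hook_coeff E (i, j) u
        - (\<Sum>k = i + 1..<j. Poly_Mapping.lookup u (i, k)) - (\<Sum>k = i + 1..<j. Poly_Mapping.lookup u (k, j))"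
      by (simp add: hook_coeff_def path_sum_hook[OF b(2)])
    moreover have "\<dots> \<in> G" by (intro G 0 1 2)
    ultimately show ?thesis by simp
  next
    case False
    then show ?thesis using 0 by (simp add: hook_coeff_def)
  qed
qed

lemma integer_lattice_hook_coeff:
  "integer_lattice n = {u \<in> coord_space n. \<forall>s\<in>segments n. hook_coeff E s u \<in> \<int>}"
proof (intro subset_antisym subsetI)
  fix u assume "u \<in> integer_lattice n"
  then have u: "u \<in> coord_space n" "\<And>s. Poly_Mapping.lookup u s \<in> \<int>" by (auto simp: integer_lattice_def)
  have "path_sum u d \<in> \<int>" for d by (induction d) (auto simp: u(2))
  then show "u \<in> {u \<in> coord_space n. \<forall>s\<in>segments n. hook_coeff E s u \<in> \<int>}"
    using u by (simp add: hook_coeff_def)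
next
  fix u assume "u \<in> {u \<in> coord_space n. \<forall>s\<in>segments n. hook_coeff E s u \<in> \<int>}"
  then have u: "u \<in> coord_space n" "\<forall>s\<in>segments n. hook_coeff E s u \<in> \<int>" by auto
  have "Poly_Mapping.lookup u s \<in> \<int>" for s
  proof (cases "s \<in> segments n")
    case True
    then show ?thesis using lookup_from_hook_coeff[OF _ _ u(2), of "fst s" "snd s"] by simp
  next
    case False
    then show ?thesis using u(1) by (cases s) (simp add: coord_space_iff)
  qed
  then show "u \<in> integer_lattice n" using u(1) by (simp add: integer_lattice_def)
qed

lemma hook_coeff_zero:
  assumes "u \<in> coord_space n" "\<forall>s\<in>segments n. hook_coeff E s u = 0"
  shows "u = 0"
proof (rule poly_mapping_eqI)
  fix s
  show "Poly_Mapping.lookup u s = Poly_Mapping.lookup 0 s"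
  proof (cases "s \<in> segments n")
    case True
    then show ?thesis
      using lookup_from_hook_coeff[of "{0}" n E u "fst s" "snd s"] assms(2) by simp
  next
    case False
    then show ?thesis using assms(1) by (cases s) (simp add: coord_space_iff)
  qed
qed

context laminar_segment_point
begin

text \<open>Positivity on \<open>E\<close> and the strict chain bound leave exactly one active
  constraint per cell: its sign condition outside \<open>E\<close>, its hook on
  \<open>E\<close>.\<close>

lemma tangent_cone_v:
  "tangent_cone (FFLV n a) v = {u \<in> coord_space n. \<forall>s\<in>segments n. 0 \<le> hook_coeff E s u}"
proof -
  have "(\<forall>i\<in>active_constraints n a v. 0 \<le> constraint_fun i u) \<longleftrightarrow>
      (\<forall>s\<in>segments n. 0 \<le> hook_coeff E s u)" for u
  proof
    assume act: "\<forall>i\<in>active_constraints n a v. 0 \<le> constraint_fun i u"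
    show "\<forall>s\<in>segments n. 0 \<le> hook_coeff E s u"
    proof
      fix s assume s: "s \<in> segments n"
      show "0 \<le> hook_coeff E s u"
      proof (cases "s \<in> E")
        case True
        then have "Inr (hook (fst s) (snd s)) \<in> active_constraints n a v"
          using s by (simp add: dyck_path_hook path_sum_hook_tight)
        from bspec[OF act this] show ?thesis using True by (simp add: hook_coeff_def)
      next
        case False
        then have "Inl s \<in> active_constraints n a v" using s by (simp add: val_outside)
        from bspec[OF act this] show ?thesis using False by (simp add: hook_coeff_def)
      qed
    qed
  next
    assume coeff: "\<forall>s\<in>segments n. 0 \<le> hook_coeff E s u"
    show "\<forall>i\<in>active_constraints n a v. 0 \<le> constraint_fun i u"
    proof
      fix i assume i: "i \<in> active_constraints n a v"
      show "0 \<le> constraint_fun i u"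
      proof (cases i)
        case (Inl s)
        then have "s \<in> segments n" "s \<notin> E" using i val_pos[of s] by auto
        then show ?thesis using coeff Inl by (auto simp: hook_coeff_def)
      next
        case (Inr d)
        then have "dyck_path n d" "path_sum v d = path_bound a d" using i by auto
        then obtain p q where pq: "(p, q) \<in> E" "d = hook p q"
          using path_sum_less_or_hook[of d] by auto
        then have "0 \<le> hook_coeff E (p, q) u" using coeff E(1) by blast
        then show ?thesis using pq Inr by (simp add: hook_coeff_def)
      qed
    qed
  qed
  then show ?thesis using tangent_cone_FFLV[OF v_FFLV] by simp
qed

text \<open>The cone is pointed: if a positive combination of two of its vectors is zero, all their
  hook coefficients vanish, hence so do the vectors.\<close>

lemma v_extreme: "v extreme_point_of FFLV n a"
  unfolding extreme_point_of_def
proof (intro conjI ballI notI)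
  show "v \<in> FFLV n a" by (rule v_FFLV)
  fix x y assume xy: "x \<in> FFLV n a" "y \<in> FFLV n a" and "v \<in> open_segment x y"
  then obtain t where t: "x \<noteq> y" "0 < t" "t < 1" "v = (1 - t) *\<^sub>R x + t *\<^sub>R y"
    by (auto simp: in_segment)
  have "x - v \<in> tangent_cone (FFLV n a) v" "y - v \<in> tangent_cone (FFLV n a) v"
    unfolding tangent_cone_def using xy by (auto intro: hull_inc)
  then have c: "x - v \<in> coord_space n" "y - v \<in> coord_space n"
    "\<And>s. s \<in> segments n \<Longrightarrow> 0 \<le> hook_coeff E s (x - v)"
    "\<And>s. s \<in> segments n \<Longrightarrow> 0 \<le> hook_coeff E s (y - v)"
    by (auto simp: tangent_cone_v)
  have zero: "(1 - t) *\<^sub>R (x - v) + t *\<^sub>R (y - v) = 0" using t(4) by (simp add: algebra_simps)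
  have "hook_coeff E s (x - v) = 0 \<and> hook_coeff E s (y - v) = 0" if s: "s \<in> segments n" for s
  proof -
    have "(1 - t) * hook_coeff E s (x - v) + t * hook_coeff E s (y - v) = 0"
      using arg_cong[OF zero, of "hook_coeff E s"] linear_hook_coeff[of E s]
      by (simp only: linear_add linear_scale linear_0 real_scaleR_def)
    then show ?thesis
      using c(3,4)[OF s] t(2,3) by (simp add: add_nonneg_eq_0_iff)
  qed
  then have "x - v = 0" "y - v = 0" using hook_coeff_zero c(1,2) by blast+
  then show False using t(1) by simp
qed

lemma v_simple: "simple_vertex (integer_lattice n) (FFLV n a) v"
proof -
  have "\<forall>s. \<exists>u. u \<in> coord_space n \<and> (\<forall>t\<in>segments n. hook_coeff E t u = (if s = t then 1 else 0))"
  proof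
    fix s
    show "\<exists>u. u \<in> coord_space n \<and> (\<forall>t\<in>segments n. hook_coeff E t u = (if s = t then 1 else 0))"
      using hook_coeff_surj[of n E "\<lambda>t. if s = t then 1 else 0"] by blast
  qed
  from choice[OF this] obtain b where
    "\<forall>s. b s \<in> coord_space n \<and> (\<forall>t\<in>segments n. hook_coeff E t (b s) = (if s = t then 1 else 0))" ..
  then have b: "b s \<in> coord_space n"
    "t \<in> segments n \<Longrightarrow> hook_coeff E t (b s) = (if s = t then 1 else 0)" for s t by blast+
  note facts = subspace_coord_space finite_segments linear_hook_coeff b(1)
  have "simplicial_cone (tangent_cone (FFLV n a) v)"
    unfolding tangent_cone_v by (rule dual_basis_cone(1)[OF facts]) (auto simp: b(2) hook_coeff_zero)
  moreover have "unimodular_cone (integer_lattice n) (tangent_cone (FFLV n a) v)"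
    unfolding tangent_cone_v integer_lattice_hook_coeff[of n E]
    by (rule dual_basis_cone(2)[OF facts]) (auto simp: b(2) hook_coeff_zero)
  ultimately show ?thesis unfolding simple_vertex_def using v_extreme by blast
qed

end

lemma laminar_iff_segments:
  assumes "E \<subseteq> segments n"
  shows "laminar E \<longleftrightarrow> (\<forall>s \<in> E. \<forall>t \<in> E. segment s \<inter> segment t \<noteq> {} \<longrightarrow>
               segment s \<inter> segment t = segment s \<or> segment s \<inter> segment t = segment t)"
    (is "_ \<longleftrightarrow> ?R")
proof
  assume lam: "laminar E"
  show ?R
  proof (intro ballI impI)
    fix s t assume s: "s \<in> E" and t: "t \<in> E" and ne: "segment s \<inter> segment t \<noteq> {}"
    then have "fst t \<le> snd s" "fst s \<le> snd t" by (auto simp: segment_def)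
    then have "snd t \<le> snd s \<and> fst s \<le> fst t \<or> snd s \<le> snd t \<and> fst t \<le> fst s"
      using lam s t unfolding laminar_def by (metis linorder_neqE_nat nat_le_linear order.refl less_imp_le)
    then show "segment s \<inter> segment t = segment s \<or> segment s \<inter> segment t = segment t"
      by (auto simp: segment_def)
  qed
next
  assume R: ?R
  show "laminar E" unfolding laminar_def
  proof (intro ballI impI)
    fix s t assume s: "s \<in> E" and t: "t \<in> E" and lt: "fst s < fst t" and le: "fst t \<le> snd s"
    have seg: "fst s < snd s" "fst t < snd t" using assms s t by (auto simp: segments_iff)
    \<comment> \<open>The start of \<open>s\<close> lies outside \<open>t\<close>, so the
      intersection is not \<open>s\<close> and must be \<open>t\<close>.\<close>
    have mem: "real (fst t) \<in> segment s \<inter> segment t" "real (fst s) \<in> segment s"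
      "real (fst s) \<notin> segment t" "real (snd t) \<in> segment t"
      using seg lt le by (auto simp: segment_def)
    then have "segment s \<inter> segment t = segment t" using R s t by blast
    then have "real (snd t) \<in> segment s" using mem(4) by blast
    then show "snd t \<le> snd s" by (simp add: segment_def)
  qed
qed

theorem theorem1p4:
  fixes n :: nat and a :: "nat \<Rightarrow> nat"
  assumes "n \<ge> 2"
    and "\<And>i. i \<in> {1..n - 1} \<Longrightarrow> a i > 0"
  shows "(\<forall>v. simple_vertex (integer_lattice n) (FFLV n a) v \<longrightarrow>
            (\<exists>E \<subseteq> segments n. v = segment_point n a E)) \<and>
         (\<forall>E \<subseteq> segments n.
            simple_vertex (integer_lattice n) (FFLV n a) (segment_point n a E) \<longleftrightarrow>
            (\<forall>s \<in> E. \<forall>t \<in> E. segment s \<inter> segment t \<noteq> {} \<longrightarrow>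
               segment s \<inter> segment t = segment s \<or> segment s \<inter> segment t = segment t))"
proof -
  have a: "\<forall>i\<in>{1..n - 1}. a i > 0" using assms(2) by blast
  have vertex: "FFLV_simplicial_vertex n a v" if "simple_vertex (integer_lattice n) (FFLV n a) v" for v
    using that a by unfold_locales (auto simp: simple_vertex_def extreme_point_of_def)
  show ?thesis
  proof (intro conjI allI impI)
    fix v assume "simple_vertex (integer_lattice n) (FFLV n a) v"
    then interpret FFLV_simplicial_vertex n a v by (rule vertex)
    show "\<exists>E \<subseteq> segments n. v = segment_point n a E"
      using v_eq_segment_point by (intro exI[of _ supp]) (auto simp: supp_def)
  next
    fix E assume E: "E \<subseteq> segments n"
    let ?v = "segment_point n a E"
    have "simple_vertex (integer_lattice n) (FFLV n a) ?v \<longleftrightarrow> laminar E"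
    proof
      assume simple: "simple_vertex (integer_lattice n) (FFLV n a) ?v"
      interpret FFLV_simplicial_vertex n a ?v
        using simple by (rule vertex)
      have spec: "is_segment_point n a E ?v" by (rule segment_point_spec)
      \<comment> \<open>A priori \<open>x(E)\<close> might vanish somewhere on \<open>E\<close>; its
        defining equation makes the hook tight, and this forces a nonzero value.\<close>
      have "(i, j) \<in> supp \<longleftrightarrow> (i, j) \<in> E" if ij: "(i, j) \<in> segments n" for i j
      proof
        assume "(i, j) \<in> supp"
        then show "(i, j) \<in> E" using spec ij by (auto simp: is_segment_point_def supp_def)
      next
        assume "(i, j) \<in> E"
        then have "tight (hook i j)"
          using spec ij path_bound_hook[OF ij, of a] dyck_path_hook[OF ij]
          by (auto simp: is_segment_point_def tight_def)
        then show "(i, j) \<in> supp" using tight_hook_iff[OF ij] by simp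
      qed
      then have "supp = E" using E by (auto simp: supp_def)
      then show "laminar E" using laminar_supp by simp
    next
      assume "laminar E"
      then interpret laminar_segment_point n a E ?v using a E by unfold_locales auto
      show "simple_vertex (integer_lattice n) (FFLV n a) ?v" by (rule v_simple)
    qed
    then show "simple_vertex (integer_lattice n) (FFLV n a) ?v \<longleftrightarrow>
        (\<forall>s \<in> E. \<forall>t \<in> E. segment s \<inter> segment t \<noteq> {} \<longrightarrow>
           segment s \<inter> segment t = segment s \<or> segment s \<inter> segment t = segment t)"
      using laminar_iff_segments[OF E] by simp
  qed
qed

end
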